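(* Let $r>1$, let $X=[0,1]$ be the unit interval (with its usual $\sigma$-algebra) and $\lambda$ the Lebesgue measure on $X$. Consider the experiment $\mathcal{E} = (X, P_f ; f\in\Theta)$, where $$\Theta=\Big\{f\colon X\to\mathbf{R} \text{ measurable} \;\Big|\; \tfrac1r\leq f,\ \int f\,d\lambda=1\Big\},\qquad dP_f=f\,d\lambda.$$ Then for every $n\in\{1,2,\dotsc\}$ $$c\,\frac{1}{\sqrt{n+1}}\leq\delta(\mathcal{E}^{\otimes n},\mathcal{E}^{\otimes n+1})\leq C\,\frac{1}{\sqrt{n+1}},$$ where $c=\frac{1-1/r}{12\sqrt2}$ and $C=\sqrt{\frac{\pi}{2}}\,r<1.3\,r$.
   Context: An experiment $\mathcal{E} = (X, P_{\theta} ; \theta \in \Theta)$ consists of a parameter set $\Theta$, a measurable space $X$ (the sample space) and a family $(P_\theta)_{\theta\in\Theta}$ of probability measures on $X$. For $n \in \{1,2,\dotsc\}$ its $n$-fold repetition is $\mathcal{E}^{\otimes n} = (X^{\otimes n}, P_\theta^{\otimes n} ; \theta\in\Theta)$, with $X^{\otimes n}$ the $n$-fold product measurable space and $P_\theta^{\otimes n}$ the $n$-fold product measure. A finite normalised decision problem on $\Theta$ is a pair $(A,L)$ with $A$ a finite set (with the discrete $\sigma$-algebra) and $L \colon A\times\Theta\to[0,1]$. A decision procedure for $(A,L)$ on observing $\mathcal{E}$ is a Markov kernel $\rho$ from $X$ to $A$, and its risk at $\theta$ is $R_{\mathcal{E}}(\rho,\theta)=\int\int L(a,\theta)\,\rho_x(da)\,P_\theta(dx)$.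 For two experiments $\mathcal{E}$ and $\mathcal{F}$ on the same parameter set $\Theta$ (with possibly different sample spaces $X$ and $Y$), the deficiency $\delta(\mathcal{E},\mathcal{F})$ is the smallest number (infimum) $\varepsilon\geq 0$ such that for every finite normalised decision problem $(A,L)$ on $\Theta$ and every decision procedure $\rho$ on $Y$ there exists a decision procedure $\rho'$ on $X$ with $R_{\mathcal{E}}(\rho',\theta)\leq R_{\mathcal{F}}(\rho,\theta)+\varepsilon$ for all $\theta\in\Theta$. *)

theory Defs
  imports "HOL-Probability.Probability"
begin

record ('t, 'x) stat_experiment =
  params :: "'t set"
  sample_space :: "'x measure"
  law :: "'t \<Rightarrow> 'x measure"

text \<open>
  Only the measurable structure of \<open>sample_space E\<close> matters, never the values of that measure.
  The elements of \<open>space (prob_algebra X)\<close> are the probability measures on the measurable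
  space \<open>X\<close>, and a Markov kernel from \<open>X\<close> to \<open>Y\<close> is an element of \<open>X \<rightarrow>\<^sub>M prob_algebra Y\<close>.
\<close>

definition is_experiment :: "('t, 'x) stat_experiment \<Rightarrow> bool" where
  "is_experiment E \<longleftrightarrow>
     (\<forall>\<theta>\<in>params E. law E \<theta> \<in> space (prob_algebra (sample_space E)))"

definition experiment_power ::
  "('t, 'x) stat_experiment \<Rightarrow> nat \<Rightarrow> ('t, nat \<Rightarrow> 'x) stat_experiment" where
  "experiment_power E n =
     \<lparr> params = params E,
       sample_space = (\<Pi>\<^sub>M i\<in>{..<n}. sample_space E),
       law = (\<lambda>\<theta>. \<Pi>\<^sub>M i\<in>{..<n}. law E \<theta>) \<rparr>"

text \<open>
  A definition cannot quantify over all finite types or sets of all types, so the finite action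
  sets are taken to be finite subsets of \<open>nat\<close>; every finite set is in bijection with one of them.
\<close>

definition decision_problem :: "'t set \<Rightarrow> nat set \<Rightarrow> (nat \<Rightarrow> 't \<Rightarrow> real) \<Rightarrow> bool" where
  "decision_problem \<Theta> A L \<longleftrightarrow>
     finite A \<and> (\<forall>a\<in>A. \<forall>\<theta>\<in>\<Theta>. L a \<theta> \<in> {0..1})"

definition decision_procedures ::
  "('t, 'x) stat_experiment \<Rightarrow> nat set \<Rightarrow> ('x \<Rightarrow> nat measure) set" where
  "decision_procedures E A = sample_space E \<rightarrow>\<^sub>M prob_algebra (count_space A)"

definition risk ::
  "('t, 'x) stat_experiment \<Rightarrow> (nat \<Rightarrow> 't \<Rightarrow> real) \<Rightarrow> ('x \<Rightarrow> nat measure) \<Rightarrow> 't \<Rightarrow> real" where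
  "risk E L \<rho> \<theta> = (\<integral>x. (\<integral>a. L a \<theta> \<partial>(\<rho> x)) \<partial>(law E \<theta>))"

text \<open>
  The deficiency is meant for experiments with \<open>params E = params F\<close>. The set below is bounded
  below by 0 and, for experiments with a nonempty sample space, contains 1, so the infimum of
  reals is the genuine one.
\<close>

definition deficiency ::
  "('t, 'x) stat_experiment \<Rightarrow> ('t, 'y) stat_experiment \<Rightarrow> real" where
  "deficiency E F =
     Inf {\<epsilon>. 0 \<le> \<epsilon> \<and>
       (\<forall>A L. decision_problem (params E) A L \<longrightarrow>
         (\<forall>\<rho>\<in>decision_procedures F A. \<exists>\<rho>'\<in>decision_procedures E A.
           \<forall>\<theta>\<in>params E. risk E L \<rho>' \<theta> \<le> risk F L \<rho> \<theta> + \<epsilon>))}"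

definition unit_lebesgue :: "real measure" where
  "unit_lebesgue = restrict_space lborel {0..1}"

text \<open>
  Membership in \<open>extensional {0..1}\<close> makes the parameters functions on the unit interval rather
  than on the whole line. The Bochner integral of a non-integrable function is 0, so the last
  condition includes integrability.
\<close>

definition densities :: "real \<Rightarrow> (real \<Rightarrow> real) set" where
  "densities r =
     {f \<in> extensional {0..1}. f \<in> borel_measurable unit_lebesgue \<and>
        (\<forall>x\<in>{0..1}. 1 / r \<le> f x) \<and> (\<integral>x. f x \<partial>unit_lebesgue) = 1}"

definition density_experiment :: "real \<Rightarrow> (real \<Rightarrow> real, real) stat_experiment" where
  "density_experiment r =
     \<lparr> params = densities r,
       sample_space = unit_lebesgue,
       law = (\<lambda>f. density unit_lebesgue (\<lambda>x. ennreal (f x))) \<rparr>"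

lemma is_experiment_density_experiment:
  assumes "0 < r"
  shows "is_experiment (density_experiment r)"
proof -
  have "prob_space (density unit_lebesgue (\<lambda>x. ennreal (f x)))" if f: "f \<in> densities r" for f
  proof (rule prob_spaceI)
    have meas: "f \<in> borel_measurable unit_lebesgue" and int1: "(\<integral>x. f x \<partial>unit_lebesgue) = 1"
      using f by (auto simp: densities_def)
    have space: "space unit_lebesgue = {0..1}"
      by (simp add: unit_lebesgue_def space_restrict_space)
    have "0 \<le> f x" if "x \<in> space unit_lebesgue" for x
    proof -
      have "1 / r \<le> f x" using f that space by (auto simp: densities_def)
      moreover have "0 < 1 / r" using assms by simp
      ultimately show ?thesis by linarith
    qed
    moreover have "integrable unit_lebesgue f"
      using int1 not_integrable_integral_eq by fastforce
    ultimately have "(\<integral>\<^sup>+x. ennreal (f x) \<partial>unit_lebesgue) = 1"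
      using int1 by (subst nn_integral_eq_integral) auto
    moreover have "emeasure (density unit_lebesgue (\<lambda>x. ennreal (f x))) (space unit_lebesgue)
        = (\<integral>\<^sup>+x. ennreal (f x) \<partial>unit_lebesgue)"
      using meas by (subst emeasure_density) (auto intro!: nn_integral_cong)
    ultimately show "emeasure (density unit_lebesgue (\<lambda>x. ennreal (f x)))
        (space (density unit_lebesgue (\<lambda>x. ennreal (f x)))) = 1"
      by simp
  qed
  then show ?thesis
    by (auto simp: is_experiment_def density_experiment_def space_prob_algebra)
qed

lemma is_experiment_power:
  assumes "is_experiment E"
  shows "is_experiment (experiment_power E n)"
  using assms
  by (auto simp: is_experiment_def experiment_power_def space_prob_algebra
      intro!: prob_space_PiM sets_PiM_cong)

end

theory Submission
  imports Defs
begin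

text \<open>
  Upper bound: given \<open>n\<close> observations, insert an artificial one drawn from Lebesgue measure at a
  uniformly random position. The resulting law has density \<open>y \<mapsto> (\<Sum>i\<le>n. 1 / f (y i)) / (n + 1)\<close> with
  respect to \<open>n + 1\<close> genuine observations. This is an average of independent variables with mean 1
  and values in \<open>[0, r]\<close>, so its \<open>L\<^sup>1\<close> distance from 1 is at most \<open>r / sqrt (n + 1)\<close>.

  Lower bound: cut the unit interval into \<open>m\<close> blocks of \<open>m\<close> cells, select one cell per block and
  spread mass \<open>1 - 1 / r\<close> uniformly over the selected cells, on top of the constant \<open>1 / r\<close>. The
  statistician names at most \<open>n + 1\<close> cells and loses unless more than \<open>j\<close> of them are selected.
  For large \<open>m\<close> an unobserved cell is almost never a correct guess and observations almost never
  share a selected cell, so the optimal success probability is that of a binomial variable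
  exceeding \<open>j\<close>. One more trial with success probability \<open>q\<close> raises it by \<open>q\<close> times the
  probability of exactly \<open>j\<close> successes among \<open>n\<close>, which by Chebyshev's inequality is of order
  \<open>1 / sqrt n\<close> for a suitable \<open>j\<close>.
\<close>

section \<open>Integrals over product measures\<close>

text \<open>The usual source of integrability below: integrands are bounded on a probability space.
  The bound is asked only on \<open>space M\<close>, because kernels and densities are controlled
  only there.\<close>

lemma integrable_prob_bounded:
  fixes h :: "'a \<Rightarrow> real"
  assumes "prob_space M" "h \<in> borel_measurable M" "\<And>x. x \<in> space M \<Longrightarrow> \<bar>h x\<bar> \<le> C"
  shows "integrable M h"
proof -
  interpret prob_space M by fact
  show ?thesis using assms by (intro integrable_const_bound[of _ C]) auto
qed

lemma PiM_coord_in_space: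
  "x \<in> space (PiM I (\<lambda>_. M)) \<Longrightarrow> i \<in> I \<Longrightarrow> x i \<in> space M"
  by (auto simp: space_PiM)

lemma PiM_upd_measurable:
  "(\<lambda>(x, u). x(n := u)) \<in> PiM {..<n} (\<lambda>_. M) \<Otimes>\<^sub>M M \<rightarrow>\<^sub>M PiM {..<Suc n} (\<lambda>_. M)"
  using measurable_add_dim[of n "{..<n}" "\<lambda>_. M"] by (simp add: lessThan_Suc)

lemma integral_PiM_Suc:
  fixes h :: "(nat \<Rightarrow> 'a) \<Rightarrow> real"
  assumes M: "prob_space M" and h: "h \<in> borel_measurable (PiM {..<Suc n} (\<lambda>_. M))"
    and b: "\<And>x. x \<in> space (PiM {..<Suc n} (\<lambda>_. M)) \<Longrightarrow> \<bar>h x\<bar> \<le> C"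
  shows "(\<integral>y. h y \<partial>PiM {..<Suc n} (\<lambda>_. M)) = (\<integral>x. (\<integral>u. h (x(n := u)) \<partial>M) \<partial>PiM {..<n} (\<lambda>_. M))"
proof -
  interpret prob_space M by fact
  interpret product_sigma_finite "\<lambda>_::nat. M" by standard
  have "integrable (PiM {..<Suc n} (\<lambda>_. M)) h"
    by (rule integrable_prob_bounded[OF prob_space_PiM h b]) (use M in auto)
  then show ?thesis
    using product_integral_insert[of "{..<n}" n h] by (simp add: lessThan_Suc)
qed

text \<open>Independent, identically distributed coordinates are exchangeable. This lets an
  artificial observation at position \<open>i\<close> be treated as the last one, where Fubini
  applies.\<close>

lemma integral_PiM_transpose:
  fixes h :: "(nat \<Rightarrow> 'a) \<Rightarrow> real"
  assumes M: "prob_space M" and h: "h \<in> borel_measurable (PiM {..<N} (\<lambda>_. M))"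
    and ij: "i < N" "j < N"
  shows "(\<integral>y. h y \<partial>PiM {..<N} (\<lambda>_. M))
       = (\<integral>y. h (y(i := y j, j := y i)) \<partial>PiM {..<N} (\<lambda>_. M))"
proof -
  let ?P = "PiM {..<N} (\<lambda>_. M)"
  let ?t = "\<lambda>y. \<lambda>k\<in>{..<N}. y (Transposition.transpose i j k)"
  have t: "distr ?P ?P ?t = ?P"
    using distr_PiM_reindex[of "{..<N}" "\<lambda>_. M" "Transposition.transpose i j" "{..<N}"] M ij
    by (auto simp: Transposition.transpose_def)
  have tm: "?t \<in> ?P \<rightarrow>\<^sub>M ?P"
    using ij by (intro measurable_restrict measurable_component_singleton)
      (auto simp: Transposition.transpose_def)
  have "(\<integral>y. h y \<partial>?P) = (\<integral>y. h y \<partial>distr ?P ?P ?t)" by (simp only: t)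
  also have "\<dots> = (\<integral>y. h (?t y) \<partial>?P)" using h tm by (intro integral_distr)
  also have "\<dots> = (\<integral>y. h (y(i := y j, j := y i)) \<partial>?P)"
  proof (intro Bochner_Integration.integral_cong refl arg_cong[of _ _ h] ext)
    fix y k assume "y \<in> space ?P"
    \<comment> \<open>Outside \<open>{..<N}\<close> both sides are \<open>undefined\<close>, by
      extensionality of \<open>y\<close>.\<close>
    then show "?t y k = (y(i := y j, j := y i)) k"
      using ij by (auto simp: space_PiM PiE_def extensional_def Transposition.transpose_def)
  qed
  finally show ?thesis .
qed

text \<open>Integrating out the last coordinate removes the cross term, since \<open>g\<close> is
  centred, so each coordinate adds one copy of the variance.\<close>

lemma second_moment_sum_centered:
  fixes g :: "'a \<Rightarrow> real"
  assumes M: "prob_space M" and g: "g \<in> borel_measurable M"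
    and b: "\<And>u. u \<in> space M \<Longrightarrow> \<bar>g u\<bar> \<le> C" and z: "(\<integral>u. g u \<partial>M) = 0"
  shows "(\<integral>x. (\<Sum>i<n. g (x i))\<^sup>2 \<partial>PiM {..<n} (\<lambda>_. M)) = real n * (\<integral>u. (g u)\<^sup>2 \<partial>M)"
proof (induction n)
  case 0
  show ?case by simp
next
  case (Suc n)
  interpret prob_space M by fact
  let ?P = "\<lambda>n. PiM {..<n} (\<lambda>_. M)"
  have P: "prob_space (?P n)" for n by (intro prob_space_PiM M)
  interpret Pn: prob_space "?P n" by (rule P)
  have meas [measurable]: "(\<lambda>x. \<Sum>i<k. g (x i)) \<in> borel_measurable (?P k)" for k
    by (intro borel_measurable_sum measurable_compose[OF measurable_component_singleton]) (auto intro: g)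
  have bnd: "\<bar>\<Sum>i<k. g (x i)\<bar> \<le> real k * C" if "x \<in> space (?P k)" for x k
  proof -
    have "\<bar>\<Sum>i<k. g (x i)\<bar> \<le> (\<Sum>i<k. \<bar>g (x i)\<bar>)" by (rule sum_abs)
    also have "\<dots> \<le> (\<Sum>i<k. C)"
      using that by (intro sum_mono b) (auto simp: space_PiM)
    finally show ?thesis by simp
  qed
  have bnd2: "\<bar>(\<Sum>i<k. g (x i))\<^sup>2\<bar> \<le> (real k * C)\<^sup>2" if "x \<in> space (?P k)" for x k
    using power_mono[OF bnd[OF that] abs_ge_zero, of 2] by simp
  have g_int: "integrable M g" using b by (rule integrable_prob_bounded[OF M g])
  have g2_int: "integrable M (\<lambda>u. (g u)\<^sup>2)"
  proof (rule integrable_prob_bounded[OF M])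
    show "\<bar>(g u)\<^sup>2\<bar> \<le> C\<^sup>2" if "u \<in> space M" for u
      using power_mono[OF b[OF that] abs_ge_zero, of 2] by simp
  qed (use g in measurable)
  have "(\<integral>x. (\<Sum>i<Suc n. g (x i))\<^sup>2 \<partial>?P (Suc n))
      = (\<integral>x. (\<integral>u. (\<Sum>i<Suc n. g ((x(n := u)) i))\<^sup>2 \<partial>M) \<partial>?P n)"
    by (rule integral_PiM_Suc[OF M _ bnd2]) measurable
  also have "\<dots> = (\<integral>x. (\<Sum>i<n. g (x i))\<^sup>2 + (\<integral>u. (g u)\<^sup>2 \<partial>M) \<partial>?P n)"
  proof (rule Bochner_Integration.integral_cong[OF refl])
    fix x
    have "(\<integral>u. (\<Sum>i<Suc n. g ((x(n := u)) i))\<^sup>2 \<partial>M)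
        = (\<integral>u. (\<Sum>i<n. g (x i))\<^sup>2 + 2 * (\<Sum>i<n. g (x i)) * g u + (g u)\<^sup>2 \<partial>M)"
      by (intro Bochner_Integration.integral_cong refl) (simp add: power2_sum)
    also have "\<dots> = (\<Sum>i<n. g (x i))\<^sup>2 + (\<integral>u. (g u)\<^sup>2 \<partial>M)"
      using g_int g2_int z by (simp add: prob_space)
    finally show "(\<integral>u. (\<Sum>i<Suc n. g ((x(n := u)) i))\<^sup>2 \<partial>M)
        = (\<Sum>i<n. g (x i))\<^sup>2 + (\<integral>u. (g u)\<^sup>2 \<partial>M)" .
  qed
  also have "\<dots> = real n * (\<integral>u. (g u)\<^sup>2 \<partial>M) + (\<integral>u. (g u)\<^sup>2 \<partial>M)"
  proof -
    have "integrable (?P n) (\<lambda>x. (\<Sum>i<n. g (x i))\<^sup>2)"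
      by (rule integrable_prob_bounded[OF P _ bnd2]) measurable
    then show ?thesis using Suc by (simp add: Pn.prob_space)
  qed
  finally show ?case by (simp add: algebra_simps)
qed

text \<open>Cauchy-Schwarz by way of the pointwise inequality between arithmetic and geometric mean
  of \<open>(v x)\<^sup>2 / \<kappa>\<close> and \<open>\<kappa>\<close>.\<close>

lemma integral_abs_le_of_square:
  fixes v :: "'a \<Rightarrow> real"
  assumes M: "prob_space M" and v: "v \<in> borel_measurable M" and b: "\<And>x. x \<in> space M \<Longrightarrow> \<bar>v x\<bar> \<le> C"
    and k: "0 < \<kappa>" and sq: "(\<integral>x. (v x)\<^sup>2 \<partial>M) \<le> \<kappa>\<^sup>2"
  shows "(\<integral>x. \<bar>v x\<bar> \<partial>M) \<le> \<kappa>"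
proof -
  interpret prob_space M by fact
  have i1: "integrable M (\<lambda>x. \<bar>v x\<bar>)"
    by (rule integrable_prob_bounded[OF M, of _ C]) (use v b in auto)
  have i2: "integrable M (\<lambda>x. (v x)\<^sup>2)"
  proof (rule integrable_prob_bounded[OF M])
    show "\<bar>(v x)\<^sup>2\<bar> \<le> C\<^sup>2" if "x \<in> space M" for x
      using power_mono[OF b[OF that] abs_ge_zero, of 2] by simp
  qed (use v in measurable)
  have "(\<integral>x. \<bar>v x\<bar> \<partial>M) \<le> (\<integral>x. ((v x)\<^sup>2 / \<kappa> + \<kappa>) / 2 \<partial>M)"
  proof (rule integral_mono[OF i1])
    show "integrable M (\<lambda>x. ((v x)\<^sup>2 / \<kappa> + \<kappa>) / 2)" using i2 by auto
    fix x
    have "0 \<le> (\<bar>v x\<bar> - \<kappa>)\<^sup>2" by simp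
    then have "2 * \<kappa> * \<bar>v x\<bar> \<le> (v x)\<^sup>2 + \<kappa>\<^sup>2" by (simp add: power2_diff algebra_simps)
    then show "\<bar>v x\<bar> \<le> ((v x)\<^sup>2 / \<kappa> + \<kappa>) / 2"
      using k by (simp add: field_simps power2_eq_square)
  qed
  also have "\<dots> = ((\<integral>x. (v x)\<^sup>2 \<partial>M) / \<kappa> + \<kappa>) / 2"
    using i2 by (simp add: prob_space)
  also have "\<dots> \<le> (\<kappa>\<^sup>2 / \<kappa> + \<kappa>) / 2" using sq k by (simp add: divide_right_mono)
  also have "\<dots> = \<kappa>" using k by (simp add: power2_eq_square)
  finally show ?thesis .
qed

text \<open>Both measures are compared on rectangles, where Tonelli factorises the integral of the
  product density. In the lower bound this produces the likelihood with respect to uniform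
  sampling.\<close>

lemma PiM_density:
  assumes M: "prob_space M" and f: "f \<in> borel_measurable M" "\<And>u. u \<in> space M \<Longrightarrow> 0 \<le> f u"
    and D: "prob_space (density M (\<lambda>u. ennreal (f u)))" and I: "finite I"
  shows "PiM I (\<lambda>_. density M (\<lambda>u. ennreal (f u))) = density (PiM I (\<lambda>_. M)) (\<lambda>x. ennreal (\<Prod>i\<in>I. f (x i)))"
    (is "PiM I (\<lambda>_. ?D) = ?R")
proof -
  interpret M: prob_space M by fact
  interpret D: prob_space ?D by fact
  interpret PM: product_sigma_finite "\<lambda>_. M" by standard
  interpret PD: product_sigma_finite "\<lambda>_. ?D" by standard
  have fm: "(\<lambda>x. \<Prod>i\<in>I. f (x i)) \<in> borel_measurable (PiM I (\<lambda>_. M))"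
    by (intro borel_measurable_prod measurable_compose[OF measurable_component_singleton]) (auto intro: f)
  have "?R = PiM I (\<lambda>_. ?D)"
  proof (rule PD.PiM_eqI[OF I])
    show "sets ?R = sets (PiM I (\<lambda>_. ?D))"
      unfolding sets_density by (rule sets_PiM_cong) auto
    fix A assume A: "\<And>i. i \<in> I \<Longrightarrow> A i \<in> sets ?D"
    then have A': "A i \<in> sets M" if "i \<in> I" for i using that by simp
    have "emeasure ?R (PiE I A) = (\<integral>\<^sup>+x. ennreal (\<Prod>i\<in>I. f (x i)) * indicator (PiE I A) x \<partial>PiM I (\<lambda>_. M))"
      using A' fm I by (intro emeasure_density sets_PiM_I_finite) auto
    also have "\<dots> = (\<integral>\<^sup>+x. (\<Prod>i\<in>I. ennreal (f (x i)) * indicator (A i) (x i)) \<partial>PiM I (\<lambda>_. M))"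
    proof (rule nn_integral_cong)
      fix x assume x: "x \<in> space (PiM I (\<lambda>_. M))"
      have "(\<Prod>i\<in>I. ennreal (f (x i))) = ennreal (\<Prod>i\<in>I. f (x i))"
        using f(2) PiM_coord_in_space[OF x] by (intro prod_ennreal) auto
      moreover have "(\<Prod>i\<in>I. indicator (A i) (x i)) = (indicator (PiE I A) x :: ennreal)"
      proof (cases "x \<in> PiE I A")
        case True
        then show ?thesis by (auto intro!: prod.neutral simp: PiE_def Pi_def)
      next
        case False
        then obtain i where "i \<in> I" "x i \<notin> A i" using x by (auto simp: PiE_def space_PiM)
        then show ?thesis using False I by (auto simp: prod_zero_iff intro!: bexI[of _ i])
      qed
      ultimately show "ennreal (\<Prod>i\<in>I. f (x i)) * indicator (PiE I A) x
          = (\<Prod>i\<in>I. ennreal (f (x i)) * indicator (A i) (x i))"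
        by (simp add: prod.distrib)
    qed
    also have "\<dots> = (\<Prod>i\<in>I. \<integral>\<^sup>+u. ennreal (f u) * indicator (A i) u \<partial>M)"
      using A' f by (intro PM.product_nn_integral_prod I) auto
    also have "\<dots> = (\<Prod>i\<in>I. emeasure ?D (A i))"
      using A' f by (intro prod.cong refl emeasure_density[symmetric]) auto
    finally show "emeasure ?R (PiE I A) = (\<Prod>i\<in>I. emeasure ?D (A i))" .
  qed
  then show ?thesis by simp
qed

section \<open>Markov kernels into finite sets\<close>

lemma kernel_weights_measurable:
  assumes "\<rho> \<in> N \<rightarrow>\<^sub>M prob_algebra (count_space A)" "a \<in> A"
  shows "(\<lambda>x. measure (\<rho> x) {a}) \<in> borel_measurable N"
  using measurable_compose[OF assms(1) measurable_measure_prob_algebra[of "{a}"]] assms(2) by simp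

lemma kernel_space:
  assumes "\<rho> \<in> N \<rightarrow>\<^sub>M prob_algebra (count_space A)" "x \<in> space N"
  shows "prob_space (\<rho> x)" "sets (\<rho> x) = sets (count_space A)" "space (\<rho> x) = A"
proof -
  have "\<rho> x \<in> space (prob_algebra (count_space A))" using assms by (rule measurable_space)
  then show "prob_space (\<rho> x)" "sets (\<rho> x) = sets (count_space A)"
    by (auto simp: space_prob_algebra)
  then show "space (\<rho> x) = A" using sets_eq_imp_space_eq[of "\<rho> x" "count_space A"] by simp
qed

text \<open>On a finite set a probability measure is the point measure of its singleton weights, so
  kernels can be handled through the functions \<open>measure (\<rho> x) {a}\<close>.\<close>

lemma finite_kernel_integral:
  fixes L :: "'a \<Rightarrow> real"
  assumes "\<rho> \<in> N \<rightarrow>\<^sub>M prob_algebra (count_space A)" "x \<in> space N" "finite A"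
  shows "(\<integral>a. L a \<partial>\<rho> x) = (\<Sum>a\<in>A. L a * measure (\<rho> x) {a})"
proof -
  note k = kernel_space[OF assms(1,2)]
  interpret prob_space "\<rho> x" by (rule k)
  have "\<rho> x = point_measure A (\<lambda>a. emeasure (\<rho> x) {a})"
  proof (rule measure_eqI)
    show "sets (\<rho> x) = sets (point_measure A (\<lambda>a. emeasure (\<rho> x) {a}))"
      by (simp add: k sets_point_measure)
    fix B assume "B \<in> sets (\<rho> x)"
    then have B: "B \<subseteq> A" by (simp add: k)
    then have "finite B" using assms(3) finite_subset by blast
    then show "emeasure (\<rho> x) B = emeasure (point_measure A (\<lambda>a. emeasure (\<rho> x) {a})) B"
      using B assms(3)
      by (simp add: emeasure_point_measure_finite k emeasure_eq_sum_singleton[of B "\<rho> x"] subset_eq)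
  qed
  also have "\<dots> = point_measure A (\<lambda>a. ennreal (measure (\<rho> x) {a}))"
    by (simp add: emeasure_eq_measure)
  finally have *: "\<rho> x = point_measure A (\<lambda>a. ennreal (measure (\<rho> x) {a}))" .
  show ?thesis
    using assms(3) by (subst *) (simp add: lebesgue_integral_point_measure_finite mult.commute)
qed

lemma finite_kernel_sum:
  assumes "\<rho> \<in> N \<rightarrow>\<^sub>M prob_algebra (count_space A)" "x \<in> space N" "finite A"
  shows "(\<Sum>a\<in>A. measure (\<rho> x) {a}) = 1"
proof -
  interpret prob_space "\<rho> x" by (rule kernel_space[OF assms(1,2)])
  show ?thesis using finite_kernel_integral[OF assms, of "\<lambda>_. 1"] by (simp add: prob_space)
qed

text \<open>The converse passage, from weights to a kernel: measurability on the discrete algebra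
  reduces to measurability of finite sums of weights.\<close>

lemma kernel_of_weights:
  fixes w :: "'a \<Rightarrow> 'x \<Rightarrow> real"
  assumes A: "finite A" and w: "\<And>a. a \<in> A \<Longrightarrow> w a \<in> borel_measurable N"
    and nn: "\<And>a x. a \<in> A \<Longrightarrow> x \<in> space N \<Longrightarrow> 0 \<le> w a x"
    and s: "\<And>x. x \<in> space N \<Longrightarrow> (\<Sum>a\<in>A. w a x) = 1"
  obtains \<rho> where "\<rho> \<in> N \<rightarrow>\<^sub>M prob_algebra (count_space A)"
    "\<And>a x. a \<in> A \<Longrightarrow> x \<in> space N \<Longrightarrow> measure (\<rho> x) {a} = w a x"
proof
  let ?\<rho> = "\<lambda>x. point_measure A (\<lambda>a. ennreal (w a x))"
  have em: "emeasure (?\<rho> x) B = (\<Sum>a\<in>B. ennreal (w a x))" if "B \<subseteq> A" for B x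
    using that A by (simp add: emeasure_point_measure_finite)
  show "?\<rho> \<in> N \<rightarrow>\<^sub>M prob_algebra (count_space A)"
  proof (rule measurable_prob_algebra_generated[where \<Omega> = A and G = "Pow A"])
    show "sets (count_space A) = sigma_sets A (Pow A)"
      using sets.sigma_sets_eq[of "count_space A"] by simp
    show "Int_stable (Pow A)" by (auto simp: Int_stable_def)
    show "prob_space (?\<rho> x)" if x: "x \<in> space N" for x
    proof (rule prob_spaceI)
      show "emeasure (?\<rho> x) (space (?\<rho> x)) = 1"
        using s[OF x] nn[OF _ x] by (simp add: em space_point_measure)
    qed
    show "(\<lambda>x. emeasure (?\<rho> x) B) \<in> borel_measurable N" if "B \<in> Pow A" for B
    proof -
      have "(\<lambda>x. \<Sum>a\<in>B. ennreal (w a x)) \<in> borel_measurable N"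
        using that w by (intro borel_measurable_sum measurable_ennreal) auto
      then show ?thesis using em[of B] that by simp
    qed
  qed (auto simp: sets_point_measure)
  fix a x assume "a \<in> A" "x \<in> space N"
  then show "measure (?\<rho> x) {a} = w a x" using em[of "{a}" x] nn by (simp add: measure_def)
qed

lemma finite_kernel_integral_bounds:
  assumes "\<rho> \<in> N \<rightarrow>\<^sub>M prob_algebra (count_space A)" "x \<in> space N" "finite A"
    and "\<And>a. a \<in> A \<Longrightarrow> L a \<in> {0..1::real}"
  shows "(\<Sum>a\<in>A. L a * measure (\<rho> x) {a}) \<in> {0..1}"
proof -
  have "(\<Sum>a\<in>A. L a * measure (\<rho> x) {a}) \<le> (\<Sum>a\<in>A. 1 * measure (\<rho> x) {a})"
    using assms(4) by (intro sum_mono mult_right_mono) auto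
  moreover have "0 \<le> (\<Sum>a\<in>A. L a * measure (\<rho> x) {a})"
    using assms(4) by (intro sum_nonneg mult_nonneg_nonneg) auto
  ultimately show ?thesis using finite_kernel_sum[OF assms(1-3)] by simp
qed

section \<open>Inserting an artificial observation\<close>

lemma swap_measurable:
  assumes "i < N" "j < N"
  shows "(\<lambda>y. y(i := y j, j := y i)) \<in> PiM {..<N} (\<lambda>_. M) \<rightarrow>\<^sub>M PiM {..<N} (\<lambda>_. M)"
proof -
  have "{..<N} = {..<N} \<union> {i}" "{..<N} = {..<N} \<union> {j}" using assms by auto
  then show ?thesis
    using assms by (intro measurable_fun_upd[where J = "{..<N}"] measurable_component_singleton) auto
qed

text \<open>
  The new observation goes to position \<open>i\<close> and the old entry there moves to position \<open>n\<close>; for the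
  exchangeable product law this is as good as shifting.
\<close>

definition insert_at :: "nat \<Rightarrow> nat \<Rightarrow> (nat \<Rightarrow> 'a) \<Rightarrow> 'a \<Rightarrow> nat \<Rightarrow> 'a" where
  "insert_at n i x u = (let y = x(n := u) in y(n := y i, i := y n))"

lemma insert_at_measurable:
  assumes "i \<le> n"
  shows "(\<lambda>(x, u). insert_at n i x u) \<in> PiM {..<n} (\<lambda>_. M) \<Otimes>\<^sub>M M \<rightarrow>\<^sub>M PiM {..<Suc n} (\<lambda>_. M)"
  using measurable_compose[OF PiM_upd_measurable[of n M] swap_measurable[of n "Suc n" i M]] assms
  by (simp add: insert_at_def Let_def case_prod_unfold)

lemma insert_at_in_space:
  assumes "i \<le> n" "x \<in> space (PiM {..<n} (\<lambda>_. M))" "u \<in> space M"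
  shows "insert_at n i x u \<in> space (PiM {..<Suc n} (\<lambda>_. M))"
  using measurable_space[OF insert_at_measurable[OF assms(1), of M], of "(x, u)"] assms(2,3)
  by (simp add: space_pair_measure)

text \<open>Exchangeability swaps positions \<open>i\<close> and \<open>n\<close>, so that the
  factor \<open>k\<close> sits on the last coordinate; Fubini then absorbs it into the law of
  \<open>u\<close>.\<close>

lemma integral_insert_at:
  fixes w :: "(nat \<Rightarrow> 'a) \<Rightarrow> real" and k :: "'a \<Rightarrow> real"
  assumes P: "prob_space P" and k: "k \<in> borel_measurable P"
    and k_bnd: "\<And>u. u \<in> space P \<Longrightarrow> 0 \<le> k u \<and> k u \<le> C"
    and w: "w \<in> borel_measurable (PiM {..<Suc n} (\<lambda>_. P))"
    and w_bnd: "\<And>y. y \<in> space (PiM {..<Suc n} (\<lambda>_. P)) \<Longrightarrow> w y \<in> {0..1}"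
    and i: "i \<le> n"
  shows "(\<integral>x. (\<integral>u. w (insert_at n i x u) \<partial>density P k) \<partial>PiM {..<n} (\<lambda>_. P))
       = (\<integral>y. w y * k (y i) \<partial>PiM {..<Suc n} (\<lambda>_. P))"
proof -
  let ?P = "\<lambda>n. PiM {..<n} (\<lambda>_. P)"
  let ?h = "\<lambda>y. w y * k (y i)"
  have h: "?h \<in> borel_measurable (?P (Suc n))"
    using w k i by (intro borel_measurable_times measurable_compose[OF measurable_component_singleton[of i] k]) auto
  have hb: "\<bar>?h y\<bar> \<le> C" if y: "y \<in> space (?P (Suc n))" for y
  proof -
    have "y i \<in> space P" using PiM_coord_in_space[OF y] i by simp
    then have "0 \<le> k (y i)" "k (y i) \<le> C" using k_bnd[of "y i"] by auto
    moreover have "0 \<le> w y" "w y \<le> 1" using w_bnd[OF y] by auto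
    ultimately have "w y * k (y i) \<le> 1 * C" by (intro mult_mono) auto
    then show ?thesis using \<open>0 \<le> w y\<close> \<open>0 \<le> k (y i)\<close> by simp
  qed
  let ?s = "\<lambda>y::nat \<Rightarrow> 'a. y(n := y i, i := y n)"
  have s: "?s \<in> ?P (Suc n) \<rightarrow>\<^sub>M ?P (Suc n)" using i by (intro swap_measurable) auto
  have "(\<integral>y. ?h y \<partial>?P (Suc n)) = (\<integral>y. ?h (?s y) \<partial>?P (Suc n))"
    using i by (intro integral_PiM_transpose[OF P h]) auto
  also have "\<dots> = (\<integral>x. (\<integral>u. ?h (?s (x(n := u))) \<partial>P) \<partial>?P n)"
    by (rule integral_PiM_Suc[OF P measurable_compose[OF s h] hb[OF measurable_space[OF s]]])
  also have "\<dots> = (\<integral>x. (\<integral>u. w (insert_at n i x u) \<partial>density P k) \<partial>?P n)"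
  proof (rule Bochner_Integration.integral_cong[OF refl])
    fix x assume x: "x \<in> space (?P n)"
    have wm: "(\<lambda>u. w (insert_at n i x u)) \<in> borel_measurable P"
      using measurable_compose[OF measurable_Pair1'[OF x] measurable_compose[OF insert_at_measurable[OF i] w]]
      by simp
    have "(\<integral>u. w (insert_at n i x u) \<partial>density P k) = (\<integral>u. k u *\<^sub>R w (insert_at n i x u) \<partial>P)"
      using k k_bnd wm by (intro integral_density) auto
    then show "(\<integral>u. ?h (?s (x(n := u))) \<partial>P) = (\<integral>u. w (insert_at n i x u) \<partial>density P k)"
      by (simp add: insert_at_def Let_def mult.commute)
  qed
  finally show ?thesis by simp
qed

text \<open>Averaging \<open>integral_insert_at\<close> over the positions multiplies
  \<open>w\<close> by \<open>1 + v\<close>, where \<open>v\<close> is the mean of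
  \<open>n + 1\<close> independent copies of \<open>k - 1\<close>. As \<open>w\<close> has values in
  [0, 1], the excess is at most the L1 norm of \<open>v\<close>, which is controlled by its second
  moment.\<close>

lemma insertion_error:
  fixes w :: "(nat \<Rightarrow> 'a) \<Rightarrow> real" and k :: "'a \<Rightarrow> real"
  assumes P: "prob_space P" and k: "k \<in> borel_measurable P"
    and k_bnd: "\<And>u. u \<in> space P \<Longrightarrow> 0 \<le> k u \<and> k u \<le> C"
    and k_int: "(\<integral>u. k u \<partial>P) = 1" and C: "1 \<le> C"
    and w: "w \<in> borel_measurable (PiM {..<Suc n} (\<lambda>_. P))"
    and w_bnd: "\<And>y. y \<in> space (PiM {..<Suc n} (\<lambda>_. P)) \<Longrightarrow> w y \<in> {0..1}"
  shows "(\<Sum>i\<le>n. \<integral>x. (\<integral>u. w (insert_at n i x u) \<partial>density P k) \<partial>PiM {..<n} (\<lambda>_. P)) / real (Suc n)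
       \<le> (\<integral>y. w y \<partial>PiM {..<Suc n} (\<lambda>_. P)) + C / sqrt (real (Suc n))"
proof -
  let ?P = "PiM {..<Suc n} (\<lambda>_. P)"
  interpret P: prob_space P by fact
  have PP: "prob_space ?P" by (intro prob_space_PiM P)
  interpret PP: prob_space ?P by fact
  let ?g = "\<lambda>u. k u - 1"
  define v where "v = (\<lambda>y. (\<Sum>i<Suc n. ?g (y i)) / real (Suc n))"
  have g: "?g \<in> borel_measurable P" using k by measurable
  \<comment> \<open>Here \<open>1 \<le> C\<close> enters: \<open>k u - 1\<close> lies between -1 and
    \<open>C - 1\<close>.\<close>
  have g_bnd: "\<bar>?g u\<bar> \<le> C" if "u \<in> space P" for u using k_bnd[OF that] C by auto
  have k_integrable: "integrable P k"
    using k_bnd by (intro integrable_prob_bounded[OF P k, of C]) force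
  have g_z: "(\<integral>u. ?g u \<partial>P) = 0" using k_int k_integrable by (simp add: P.prob_space)
  have v: "v \<in> borel_measurable ?P"
    unfolding v_def
    by (intro borel_measurable_divide borel_measurable_sum measurable_compose[OF measurable_component_singleton])
      (auto intro: g)
  have v_bnd: "\<bar>v y\<bar> \<le> C" if y: "y \<in> space ?P" for y
  proof -
    have "\<bar>\<Sum>i<Suc n. ?g (y i)\<bar> \<le> (\<Sum>i<Suc n. C)"
      by (intro order_trans[OF sum_abs] sum_mono g_bnd PiM_coord_in_space[OF y]) auto
    then show ?thesis by (simp add: v_def divide_le_eq mult.commute del: sum.lessThan_Suc)
  qed
  have "(\<integral>y. (v y)\<^sup>2 \<partial>?P) = (\<integral>y. (\<Sum>i<Suc n. ?g (y i))\<^sup>2 \<partial>?P) / (real (Suc n))\<^sup>2"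
    by (simp add: v_def power_divide del: sum.lessThan_Suc)
  also have "\<dots> = (\<integral>u. (?g u)\<^sup>2 \<partial>P) / real (Suc n)"
    by (subst second_moment_sum_centered[OF P g g_bnd g_z]) (simp_all add: power2_eq_square)
  also have "\<dots> \<le> C\<^sup>2 / real (Suc n)"
  proof (intro divide_right_mono)
    have g2: "(?g u)\<^sup>2 \<le> C\<^sup>2" if "u \<in> space P" for u
      using power_mono[OF g_bnd[OF that] abs_ge_zero, of 2] by simp
    have "(\<integral>u. (?g u)\<^sup>2 \<partial>P) \<le> (\<integral>u. C\<^sup>2 \<partial>P)"
      using g g2 by (intro integral_mono integrable_prob_bounded[OF P, of _ "C\<^sup>2"]) auto
    then show "(\<integral>u. (?g u)\<^sup>2 \<partial>P) \<le> C\<^sup>2" by (simp add: P.prob_space)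
  qed auto
  finally have sq: "(\<integral>y. (v y)\<^sup>2 \<partial>?P) \<le> (C / sqrt (real (Suc n)))\<^sup>2"
    by (simp add: power_divide)
  have v_abs: "(\<integral>y. \<bar>v y\<bar> \<partial>?P) \<le> C / sqrt (real (Suc n))"
    by (rule integral_abs_le_of_square[OF PP v v_bnd _ sq]) (use C in auto)
  have wi: "integrable ?P w" using w_bnd by (intro integrable_prob_bounded[OF PP w, of 1]) force
  have wki: "integrable ?P (\<lambda>y. w y * k (y i))" if "i \<le> n" for i
  proof (rule integrable_prob_bounded[OF PP, of _ C])
    show "(\<lambda>y. w y * k (y i)) \<in> borel_measurable ?P"
      using w k that by (intro borel_measurable_times measurable_compose[OF measurable_component_singleton[of i] k]) auto
    fix y assume y: "y \<in> space ?P"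
    have "y i \<in> space P" using PiM_coord_in_space[OF y] that by simp
    then have "0 \<le> k (y i)" "k (y i) \<le> C" using k_bnd[of "y i"] by auto
    moreover have "0 \<le> w y" "w y \<le> 1" using w_bnd[OF y] by auto
    ultimately have "w y * k (y i) \<le> 1 * C" by (intro mult_mono) auto
    then show "\<bar>w y * k (y i)\<bar> \<le> C" using \<open>0 \<le> w y\<close> \<open>0 \<le> k (y i)\<close> by simp
  qed
  have vi: "integrable ?P (\<lambda>y. \<bar>v y\<bar>)" using v_bnd v by (intro integrable_prob_bounded[OF PP, of _ C]) auto
  have "(\<Sum>i\<le>n. \<integral>x. (\<integral>u. w (insert_at n i x u) \<partial>density P k) \<partial>PiM {..<n} (\<lambda>_. P)) / real (Suc n)
      = (\<Sum>i\<le>n. \<integral>y. w y * k (y i) \<partial>?P) / real (Suc n)"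
    by (intro arg_cong2[where f = "(/)"] sum.cong refl integral_insert_at[OF P k k_bnd w w_bnd]) auto
  also have "\<dots> = (\<integral>y. (\<Sum>i\<le>n. w y * k (y i)) / real (Suc n) \<partial>?P)"
    using wki by (simp add: Bochner_Integration.integral_sum)
  also have "\<dots> = (\<integral>y. w y + w y * v y \<partial>?P)"
  proof (intro Bochner_Integration.integral_cong refl)
    fix y
    have "(\<Sum>i\<le>n. k (y i)) / real (Suc n) = 1 + v y"
      by (simp add: v_def lessThan_Suc_atMost sum_subtractf diff_divide_distrib del: sum.lessThan_Suc)
    then have "w y * ((\<Sum>i\<le>n. k (y i)) / real (Suc n)) = w y * (1 + v y)" by simp
    then show "(\<Sum>i\<le>n. w y * k (y i)) / real (Suc n) = w y + w y * v y"
      by (simp only: sum_distrib_left[symmetric] times_divide_eq_right distrib_left mult_1_right)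
  qed
  also have "\<dots> \<le> (\<integral>y. w y + \<bar>v y\<bar> \<partial>?P)"
  proof (rule integral_mono)
    show "integrable ?P (\<lambda>y. w y + w y * v y)"
    proof (intro Bochner_Integration.integrable_add wi integrable_prob_bounded[OF PP, of _ C])
      fix y assume y: "y \<in> space ?P"
      have "\<bar>w y\<bar> * \<bar>v y\<bar> \<le> 1 * C" using w_bnd[OF y] v_bnd[OF y] by (intro mult_mono) auto
      then show "\<bar>w y * v y\<bar> \<le> C" by (simp add: abs_mult)
    qed (use w v in measurable)
    show "integrable ?P (\<lambda>y. w y + \<bar>v y\<bar>)" using wi vi by simp
    fix y assume y: "y \<in> space ?P"
    have "w y * v y \<le> \<bar>w y\<bar> * \<bar>v y\<bar>" by (metis abs_ge_self abs_mult)
    also have "\<dots> \<le> 1 * \<bar>v y\<bar>" using w_bnd[OF y] by (intro mult_right_mono) auto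
    finally show "w y + w y * v y \<le> w y + \<bar>v y\<bar>" by simp
  qed
  also have "\<dots> = (\<integral>y. w y \<partial>?P) + (\<integral>y. \<bar>v y\<bar> \<partial>?P)" using wi vi by simp
  finally show ?thesis using v_abs by linarith
qed

section \<open>The density experiment and the simulation of one more observation\<close>

lemma space_unit_lebesgue [simp]: "space unit_lebesgue = {0..1}"
  by (simp add: unit_lebesgue_def space_restrict_space)

lemma prob_space_unit_lebesgue: "prob_space unit_lebesgue"
  by (rule prob_spaceI) (simp add: unit_lebesgue_def emeasure_restrict_space space_restrict_space)

lemma measurable_PiM_density:
  "(h \<in> borel_measurable (PiM I (\<lambda>_. density M f))) = (h \<in> borel_measurable (PiM I (\<lambda>_. M)))"
  by (intro arg_cong[of _ _ "\<lambda>S. h \<in> S"] measurable_cong_sets sets_PiM_cong) auto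

lemma space_PiM_density [simp]: "space (PiM I (\<lambda>_. density M f)) = space (PiM I (\<lambda>_. M))"
  by (simp add: space_PiM)

lemma prob_space_density_experiment:
  assumes "0 < r" "f \<in> densities r"
  shows "prob_space (density unit_lebesgue (\<lambda>x. ennreal (f x)))"
  using is_experiment_density_experiment[OF assms(1)] assms(2)
  by (auto simp: is_experiment_def density_experiment_def space_prob_algebra)

lemma risk_density_experiment_power:
  assumes "\<rho> \<in> decision_procedures (experiment_power (density_experiment r) n) A" "finite A"
  shows "risk (experiment_power (density_experiment r) n) L \<rho> f
       = (\<integral>x. (\<Sum>a\<in>A. L a f * measure (\<rho> x) {a}) \<partial>PiM {..<n} (\<lambda>_. density unit_lebesgue (\<lambda>x. ennreal (f x))))"
proof -
  have \<rho>: "\<rho> \<in> PiM {..<n} (\<lambda>_. unit_lebesgue) \<rightarrow>\<^sub>M prob_algebra (count_space A)"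
    using assms(1) by (simp add: decision_procedures_def experiment_power_def density_experiment_def)
  show ?thesis
    unfolding risk_def
    by (simp add: experiment_power_def density_experiment_def)
      (intro Bochner_Integration.integral_cong refl finite_kernel_integral[OF \<rho>],
       use assms(2) in auto)
qed

text \<open>The inserted observation is uniform, so the procedure does not depend on
  \<open>f\<close>. With respect to the law given by \<open>f\<close>, Lebesgue measure has density
  1/f with values in [0, r], so \<open>insertion_error\<close> with \<open>C = r\<close> serves
  every \<open>f\<close> at once.\<close>

lemma insertion_procedure:
  assumes r: "r > 1" and dp: "decision_problem (densities r) A L"
    and \<rho>: "\<rho> \<in> decision_procedures (experiment_power (density_experiment r) (n + 1)) A"
  shows "\<exists>\<rho>'\<in>decision_procedures (experiment_power (density_experiment r) n) A. \<forall>f\<in>densities r.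
      risk (experiment_power (density_experiment r) n) L \<rho>' f
        \<le> risk (experiment_power (density_experiment r) (n + 1)) L \<rho> f + r / sqrt (real (n + 1))"
proof -
  let ?U = "\<lambda>n. PiM {..<n} (\<lambda>_. unit_lebesgue)"
  interpret U: prob_space unit_lebesgue by (rule prob_space_unit_lebesgue)
  have A: "finite A" and L: "\<And>a f. a \<in> A \<Longrightarrow> f \<in> densities r \<Longrightarrow> L a f \<in> {0..1}"
    using dp by (auto simp: decision_problem_def)
  have \<rho>m: "\<rho> \<in> ?U (Suc n) \<rightarrow>\<^sub>M prob_algebra (count_space A)"
    using \<rho> by (simp add: decision_procedures_def experiment_power_def density_experiment_def)
  define w where "w = (\<lambda>a x. measure (\<rho> x) {a})"
  have w: "w a \<in> borel_measurable (?U (Suc n))" if "a \<in> A" for a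
    unfolding w_def by (rule kernel_weights_measurable[OF \<rho>m that])
  have w_bnd: "w a x \<in> {0..1}" if "x \<in> space (?U (Suc n))" for a x
    using prob_space.prob_le_1[OF kernel_space(1)[OF \<rho>m that]] by (simp add: w_def)
  \<comment> \<open>The probability of action \<open>a\<close> when a uniform \<open>u\<close> is
    inserted at a uniformly random one of the \<open>n + 1\<close> positions and
    \<open>\<rho>\<close> is applied to the result.\<close>
  define w' where "w' = (\<lambda>a x. (\<Sum>i\<le>n. \<integral>u. w a (insert_at n i x u) \<partial>unit_lebesgue) / real (Suc n))"
  have ins: "(\<lambda>u. w a (insert_at n i x u)) \<in> borel_measurable unit_lebesgue"
    if "a \<in> A" "i \<le> n" "x \<in> space (?U n)" for a i x
    using measurable_compose[OF measurable_Pair1'[OF that(3)]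
        measurable_compose[OF insert_at_measurable[OF that(2)] w[OF that(1)]]] by simp
  have ins_int: "integrable unit_lebesgue (\<lambda>u. w a (insert_at n i x u))"
    if "a \<in> A" "i \<le> n" "x \<in> space (?U n)" for a i x
    using w_bnd[OF insert_at_in_space[OF that(2,3)]]
    by (intro integrable_prob_bounded[OF prob_space_unit_lebesgue ins[OF that], of 1]) force
  have w'i: "(\<lambda>x. \<integral>u. w a (insert_at n i x u) \<partial>unit_lebesgue) \<in> borel_measurable (?U n)"
    if "a \<in> A" "i \<le> n" for a i
    using measurable_compose[OF insert_at_measurable[OF that(2)] w[OF that(1)]]
    by (intro U.borel_measurable_lebesgue_integral) (simp add: case_prod_unfold)
  have ins_bnd: "(\<integral>u. w a (insert_at n i x u) \<partial>unit_lebesgue) \<in> {0..1}"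
    if "a \<in> A" "i \<le> n" "x \<in> space (?U n)" for a i x
  proof -
    have "(\<integral>u. w a (insert_at n i x u) \<partial>unit_lebesgue) \<le> (\<integral>u. 1 \<partial>unit_lebesgue)"
      using w_bnd[OF insert_at_in_space[OF that(2,3)]] ins_int[OF that] by (intro integral_mono) auto
    then show ?thesis by (auto simp: U.prob_space[simplified] w_def)
  qed
  have w'_meas: "w' a \<in> borel_measurable (?U n)" if "a \<in> A" for a
      unfolding w'_def using w'i[OF that] by (intro borel_measurable_divide borel_measurable_sum) auto
  have w'_nonneg: "0 \<le> w' a x" if "a \<in> A" "x \<in> space (?U n)" for a x
      unfolding w'_def using ins_bnd[OF that(1) _ that(2)] by (intro divide_nonneg_nonneg sum_nonneg) auto
  have w'_sum: "(\<Sum>a\<in>A. w' a x) = 1" if x: "x \<in> space (?U n)" for x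
  proof -
    have "(\<Sum>a\<in>A. w' a x) = (\<Sum>i\<le>n. \<Sum>a\<in>A. \<integral>u. w a (insert_at n i x u) \<partial>unit_lebesgue) / real (Suc n)"
      unfolding w'_def sum_divide_distrib[symmetric] by (subst sum.swap) simp
    also have "(\<Sum>i\<le>n. \<Sum>a\<in>A. \<integral>u. w a (insert_at n i x u) \<partial>unit_lebesgue) = (\<Sum>i\<le>n. 1)"
    proof (rule sum.cong[OF refl])
      fix i assume i: "i \<in> {..n}"
      have "(\<Sum>a\<in>A. \<integral>u. w a (insert_at n i x u) \<partial>unit_lebesgue)
          = (\<integral>u. (\<Sum>a\<in>A. w a (insert_at n i x u)) \<partial>unit_lebesgue)"
        using ins_int[OF _ _ x] i by (subst Bochner_Integration.integral_sum) auto
      also have "\<dots> = (\<integral>u. 1 \<partial>unit_lebesgue)"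
        using finite_kernel_sum[OF \<rho>m insert_at_in_space[OF _ x] A] i
        by (intro Bochner_Integration.integral_cong) (auto simp: w_def)
      finally show "(\<Sum>a\<in>A. \<integral>u. w a (insert_at n i x u) \<partial>unit_lebesgue) = 1"
        by (simp add: U.prob_space[simplified])
    qed
    finally show ?thesis by simp
  qed
  obtain \<rho>' where \<rho>'m: "\<rho>' \<in> ?U n \<rightarrow>\<^sub>M prob_algebra (count_space A)"
    and \<rho>'w: "\<And>a x. a \<in> A \<Longrightarrow> x \<in> space (?U n) \<Longrightarrow> measure (\<rho>' x) {a} = w' a x"
    by (rule kernel_of_weights[OF A w'_meas w'_nonneg w'_sum]) auto
  have \<rho>'d: "\<rho>' \<in> decision_procedures (experiment_power (density_experiment r) n) A"
    using \<rho>'m by (simp add: decision_procedures_def experiment_power_def density_experiment_def)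
  show ?thesis
  proof (intro bexI[OF _ \<rho>'d] ballI)
    fix f assume f: "f \<in> densities r"
    define P where "P = density unit_lebesgue (\<lambda>x. ennreal (f x))"
    define k where "k = (\<lambda>u. 1 / f u)"
    have fm [measurable]: "f \<in> borel_measurable unit_lebesgue"
      and f_lower: "\<And>x. x \<in> {0..1} \<Longrightarrow> 1 / r \<le> f x"
      using f by (auto simp: densities_def)
    have f_pos: "0 < f x" if "x \<in> {0..1}" for x
      using f_lower[OF that] r by (meson less_le_trans less_trans zero_less_divide_1_iff zero_less_one)
    have f_nn: "0 \<le> f x" and f_nz: "f x \<noteq> 0" if "x \<in> {0..1}" for x
      using f_pos[OF that] by auto
    have P: "prob_space P" unfolding P_def by (rule prob_space_density_experiment[OF _ f]) (use r in simp)
    have spP: "space P = {0..1}" by (simp add: P_def)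
    have k [measurable]: "k \<in> borel_measurable P" by (simp add: k_def P_def)
    have k_bnd: "0 \<le> k u \<and> k u \<le> r" if "u \<in> space P" for u
    proof -
      have u: "u \<in> {0..1}" using that spP by simp
      have "1 \<le> f u * r" using f_lower[OF u] r by (simp add: divide_le_eq)
      then show ?thesis using f_pos[OF u] by (simp add: k_def divide_le_eq mult.commute)
    qed
    have Pk: "density P k = unit_lebesgue"
    proof -
      have "density P k = density unit_lebesgue (\<lambda>x. ennreal (f x) * ennreal (k x))"
        unfolding P_def by (subst density_density_eq) (auto simp: k_def)
      also have "\<dots> = density unit_lebesgue (\<lambda>_. 1)"
        by (intro density_cong AE_I2)
          (auto simp: k_def ennreal_mult[symmetric] f_nn f_nz)
      finally show ?thesis by (simp add: density_1)
    qed
    have k_int: "(\<integral>u. k u \<partial>P) = 1"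
    proof -
      have "(\<integral>u. k u \<partial>P) = (\<integral>u. f u *\<^sub>R k u \<partial>unit_lebesgue)"
        unfolding P_def by (intro integral_density) (auto simp: k_def f_nn)
      also have "\<dots> = (\<integral>u. 1 \<partial>unit_lebesgue)"
        by (intro Bochner_Integration.integral_cong) (auto simp: k_def f_nz)
      finally show ?thesis by (simp add: U.prob_space[simplified])
    qed
    \<comment> \<open>The expected loss at \<open>f\<close> when \<open>\<rho>\<close> sees
      \<open>y\<close>; this is the [0, 1]-valued function handed to
      \<open>insertion_error\<close>.\<close>
    define g where "g = (\<lambda>y. \<Sum>a\<in>A. L a f * w a y)"
    have gm: "g \<in> borel_measurable (PiM {..<Suc n} (\<lambda>_. P))"
      unfolding g_def P_def measurable_PiM_density using w
      by (intro borel_measurable_sum borel_measurable_times) auto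
    have g_bnd: "g y \<in> {0..1}" if "y \<in> space (PiM {..<Suc n} (\<lambda>_. P))" for y
      unfolding g_def w_def
      by (rule finite_kernel_integral_bounds[OF \<rho>m]) (use that L f A in \<open>auto simp: P_def\<close>)
    have "risk (experiment_power (density_experiment r) n) L \<rho>' f
        = (\<integral>x. (\<Sum>a\<in>A. L a f * measure (\<rho>' x) {a}) \<partial>PiM {..<n} (\<lambda>_. P))"
      using risk_density_experiment_power[OF \<rho>'d A] by (simp add: P_def)
    \<comment> \<open>By linearity, averaging the weights over the insertions averages the expected
      loss \<open>g\<close>.\<close>
    also have "\<dots> = (\<integral>x. (\<Sum>i\<le>n. \<integral>u. g (insert_at n i x u) \<partial>density P k) / real (Suc n) \<partial>PiM {..<n} (\<lambda>_. P))"
    proof (rule Bochner_Integration.integral_cong[OF refl])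
      fix x assume "x \<in> space (PiM {..<n} (\<lambda>_. P))"
      then have x: "x \<in> space (?U n)" by (simp add: P_def)
      have "(\<Sum>a\<in>A. L a f * measure (\<rho>' x) {a}) = (\<Sum>a\<in>A. L a f * w' a x)"
        using \<rho>'w x by simp
      also have "\<dots> = (\<Sum>i\<le>n. \<Sum>a\<in>A. L a f * (\<integral>u. w a (insert_at n i x u) \<partial>unit_lebesgue)) / real (Suc n)"
        unfolding w'_def by (subst sum.swap) (simp add: sum_distrib_left sum_divide_distrib)
      also have "\<dots> = (\<Sum>i\<le>n. \<integral>u. g (insert_at n i x u) \<partial>unit_lebesgue) / real (Suc n)"
        using ins_int[OF _ _ x]
        by (intro arg_cong2[where f = "(/)"] sum.cong refl)
          (simp add: g_def Bochner_Integration.integral_sum)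
      finally show "(\<Sum>a\<in>A. L a f * measure (\<rho>' x) {a})
          = (\<Sum>i\<le>n. \<integral>u. g (insert_at n i x u) \<partial>density P k) / real (Suc n)"
        by (simp add: Pk)
    qed
    also have "\<dots> = (\<Sum>i\<le>n. \<integral>x. (\<integral>u. g (insert_at n i x u) \<partial>density P k) \<partial>PiM {..<n} (\<lambda>_. P)) / real (Suc n)"
    proof -
      have "integrable (PiM {..<n} (\<lambda>_. P)) (\<lambda>x. \<integral>u. g (insert_at n i x u) \<partial>density P k)" if i: "i \<le> n" for i
      proof (rule integrable_prob_bounded[OF prob_space_PiM[OF P], of _ _ 1])
        show "(\<lambda>x. \<integral>u. g (insert_at n i x u) \<partial>density P k) \<in> borel_measurable (PiM {..<n} (\<lambda>_. P))"
        proof -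
          have "g \<in> borel_measurable (?U (Suc n))"
            using gm by (simp add: P_def measurable_PiM_density)
          then have "(\<lambda>x. \<integral>u. g (insert_at n i x u) \<partial>unit_lebesgue) \<in> borel_measurable (?U n)"
            using measurable_compose[OF insert_at_measurable[OF i], of g]
            by (intro U.borel_measurable_lebesgue_integral) (simp add: case_prod_unfold)
          then show ?thesis by (simp only: Pk) (simp add: P_def measurable_PiM_density)
        qed
        fix x assume "x \<in> space (PiM {..<n} (\<lambda>_. P))"
        then have x: "x \<in> space (?U n)" by (simp add: P_def)
        have b: "g (insert_at n i x u) \<in> {0..1}" if "u \<in> {0..1}" for u
          using g_bnd[unfolded P_def space_PiM_density, OF insert_at_in_space[OF i x]] that by simp
        have "(\<integral>u. g (insert_at n i x u) \<partial>unit_lebesgue) \<le> 1"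
        proof (rule U.integral_le_const)
          show "integrable unit_lebesgue (\<lambda>u. g (insert_at n i x u))"
            unfolding g_def using ins_int[OF _ i x] by (intro Bochner_Integration.integrable_sum) auto
        qed (use b in auto)
        moreover have "0 \<le> (\<integral>u. g (insert_at n i x u) \<partial>unit_lebesgue)"
          using b by (intro Bochner_Integration.integral_nonneg) auto
        ultimately show "\<bar>\<integral>u. g (insert_at n i x u) \<partial>density P k\<bar> \<le> 1" by (simp add: Pk)
      qed
      then show ?thesis by (simp add: Bochner_Integration.integral_sum)
    qed
    also have "\<dots> \<le> (\<integral>y. g y \<partial>PiM {..<Suc n} (\<lambda>_. P)) + r / sqrt (real (Suc n))"
      using r by (intro insertion_error[OF P k k_bnd k_int _ gm g_bnd]) auto
    also have "(\<integral>y. g y \<partial>PiM {..<Suc n} (\<lambda>_. P)) = risk (experiment_power (density_experiment r) (n + 1)) L \<rho> f"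
      using risk_density_experiment_power[OF \<rho> A] by (simp add: P_def g_def w_def)
    finally show "risk (experiment_power (density_experiment r) n) L \<rho>' f
        \<le> risk (experiment_power (density_experiment r) (n + 1)) L \<rho> f + r / sqrt (real (n + 1))"
      by simp
  qed
qed

section \<open>Counting observations in selected cells\<close>

text \<open>In list form one more observation is an appended entry, so inductions on the sample size
  integrate out the last coordinate.\<close>

definition cells :: "('a \<Rightarrow> nat) \<Rightarrow> nat \<Rightarrow> (nat \<Rightarrow> 'a) \<Rightarrow> nat list" where
  "cells c n x = map (\<lambda>i. c (x i)) [0..<n]"

text \<open>Hits are counted with multiplicity, which makes the count binomial. Naming the observed
  cells scores only the distinct ones, \<open>card (set l \<inter> S)\<close>.\<close>

definition count_in :: "nat set \<Rightarrow> nat list \<Rightarrow> nat" where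
  "count_in S l = length (filter (\<lambda>t. t \<in> S) l)"

lemma cells_upd: "cells c (Suc n) (x(n := u)) = cells c n x @ [c u]"
  by (auto simp: cells_def)

lemma length_cells [simp]: "length (cells c n x) = n"
  by (simp add: cells_def)

lemma count_in_snoc [simp]: "count_in S (l @ [t]) = count_in S l + of_bool (t \<in> S)"
  by (simp add: count_in_def)

text \<open>There are only countably many lists, so the list can be built entry by entry with
  \<open>measurable_compose_countable\<close>. The induction runs over prefixes inside the fixed
  product of \<open>n\<close> factors.\<close>

lemma cells_measurable:
  assumes c: "c \<in> M \<rightarrow>\<^sub>M count_space UNIV"
  shows "cells c n \<in> PiM {..<n} (\<lambda>_. M) \<rightarrow>\<^sub>M count_space UNIV"
proof -
  have "(\<lambda>x. cells c k x) \<in> PiM {..<n} (\<lambda>_. M) \<rightarrow>\<^sub>M count_space UNIV" if "k \<le> n" for k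
    using that
  proof (induction k)
    case 0
    show ?case by (simp add: cells_def)
  next
    case (Suc k)
    have "(\<lambda>x. c (x k)) \<in> PiM {..<n} (\<lambda>_. M) \<rightarrow>\<^sub>M count_space UNIV"
      using Suc.prems by (intro measurable_compose[OF measurable_component_singleton[of k] c]) auto
    then have "(\<lambda>x. l @ [c (x k)]) \<in> PiM {..<n} (\<lambda>_. M) \<rightarrow>\<^sub>M count_space UNIV" for l
      by (rule measurable_compose) simp
    then have "(\<lambda>x. cells c k x @ [c (x k)]) \<in> PiM {..<n} (\<lambda>_. M) \<rightarrow>\<^sub>M count_space UNIV"
      using Suc by (intro measurable_compose_countable[where g = "cells c k" and f = "\<lambda>l x. l @ [c (x k)]"]) auto
    then show ?case by (simp add: cells_def)
  qed
  from this[of n] show ?thesis by simp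
qed

lemma cells_fun_measurable:
  fixes F :: "nat list \<Rightarrow> real"
  assumes "c \<in> M \<rightarrow>\<^sub>M count_space UNIV"
  shows "(\<lambda>x. F (cells c n x)) \<in> borel_measurable (PiM {..<n} (\<lambda>_. M))"
  by (rule measurable_compose[OF cells_measurable[OF assms]]) simp

lemma integrable_cells:
  fixes F :: "nat list \<Rightarrow> real"
  assumes "prob_space M" "c \<in> M \<rightarrow>\<^sub>M count_space UNIV" "\<And>l. length l = n \<Longrightarrow> \<bar>F l\<bar> \<le> C"
  shows "integrable (PiM {..<n} (\<lambda>_. M)) (\<lambda>x. F (cells c n x))"
  using assms
  by (intro integrable_prob_bounded[OF prob_space_PiM cells_fun_measurable, of _ _ _ _ C]) auto

lemma integral_cells_Suc:
  fixes F :: "nat list \<Rightarrow> real"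
  assumes M: "prob_space M" and c: "c \<in> M \<rightarrow>\<^sub>M count_space UNIV" and b: "\<And>l. length l = Suc n \<Longrightarrow> \<bar>F l\<bar> \<le> C"
  shows "(\<integral>x. F (cells c (Suc n) x) \<partial>PiM {..<Suc n} (\<lambda>_. M))
       = (\<integral>x. (\<integral>u. F (cells c n x @ [c u]) \<partial>M) \<partial>PiM {..<n} (\<lambda>_. M))"
  using integral_PiM_Suc[OF M cells_fun_measurable[OF c, of F "Suc n"], of C] b by (simp add: cells_upd)

lemma of_bool_le_add: "(a \<Longrightarrow> b \<or> d) \<Longrightarrow> (of_bool a :: real) \<le> of_bool b + of_bool d"
  by (cases a; cases b; cases d) auto

section \<open>Binomial law of the number of hits\<close>

lemma Bernstein_Suc_0: "Bernstein (Suc n) 0 y = (1 - y) * Bernstein n 0 y"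
  by (simp add: Bernstein_def)

text \<open>Pascal's rule: the last trial succeeds or fails. The case split is due to truncated
  subtraction in the exponents; for \<open>n \<le> j\<close> the second term vanishes with its
  binomial coefficient.\<close>

lemma Bernstein_Suc_Suc: "Bernstein (Suc n) (Suc j) y = y * Bernstein n j y + (1 - y) * Bernstein n (Suc j) y"
proof (cases "j < n")
  case True
  then have "(1 - y) ^ (n - j) = (1 - y) * (1 - y) ^ (n - Suc j)"
    by (metis Suc_diff_Suc power_Suc)
  moreover have "(a + b) * (y * Y) * (z * e) = y * (a * Y * (z * e)) + z * (b * (y * Y) * e)"
    for a b Y z e :: real by (simp add: algebra_simps)
  ultimately show ?thesis by (simp add: Bernstein_def)
next
  case False
  then show ?thesis by (simp add: Bernstein_def binomial_eq_0)
qed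

text \<open>Isolates what the lower bound uses of a sampling law: the cell of an observation and the
  probability \<open>q\<close> of hitting \<open>S\<close>.\<close>

locale cell_sample = prob_space M for M :: "'a measure" +
  fixes c :: "'a \<Rightarrow> nat" and S :: "nat set" and q :: real
  assumes c [measurable]: "c \<in> M \<rightarrow>\<^sub>M count_space UNIV"
    and q: "q = prob {u \<in> space M. c u \<in> S}"
begin

lemma integral_of_bool_cell: "(\<integral>u. of_bool (c u \<in> B) \<partial>M) = prob {u \<in> space M. c u \<in> B}"
proof -
  have "(\<integral>u. of_bool (c u \<in> B) \<partial>M) = (\<integral>u. indicat_real {u \<in> space M. c u \<in> B} u \<partial>M)"
    by (intro Bochner_Integration.integral_cong) (auto simp: indicator_def)
  then show ?thesis by simp
qed

lemma integrable_of_bool_cell: "integrable M (\<lambda>u. of_bool (c u \<in> B) :: real)"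
proof (rule integrable_const_bound[of _ 1])
  show "(\<lambda>u. of_bool (c u \<in> B) :: real) \<in> borel_measurable M"
    by (rule measurable_compose[OF c]) simp
qed auto

lemma integral_two_valued: "(\<integral>u. (if c u \<in> S then a else b) \<partial>M) = q * a + (1 - q) * b"
proof -
  have "(\<integral>u. (if c u \<in> S then a else b) \<partial>M) = (\<integral>u. (a - b) * of_bool (c u \<in> S) + b \<partial>M)"
    by (intro Bochner_Integration.integral_cong) auto
  also have "\<dots> = (a - b) * q + b"
    using integral_of_bool_cell[of S] integrable_of_bool_cell[of S] by (simp add: q prob_space)
  finally show ?thesis by (simp add: algebra_simps)
qed

text \<open>A probability written as the integral of an indicator, so that
  \<open>integral_cells_Suc\<close> applies directly.\<close>

definition pr :: "nat \<Rightarrow> (nat list \<Rightarrow> bool) \<Rightarrow> real" where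
  "pr n Q = (\<integral>x. of_bool (Q (cells c n x)) \<partial>PiM {..<n} (\<lambda>_. M))"

lemma integrable_pr: "integrable (PiM {..<n} (\<lambda>_. M)) (\<lambda>x. of_bool (Q (cells c n x)) :: real)"
  by (rule integrable_cells[OF prob_space_axioms c, of n "\<lambda>l. of_bool (Q l)" 1]) auto

lemma pr_Suc: "pr (Suc n) Q = (\<integral>x. (\<integral>u. of_bool (Q (cells c n x @ [c u])) \<partial>M) \<partial>PiM {..<n} (\<lambda>_. M))"
  unfolding pr_def by (rule integral_cells_Suc[OF prob_space_axioms c, of n "\<lambda>l. of_bool (Q l)" 1]) auto

lemma pr_count_Suc:
  "pr (Suc n) (\<lambda>l. R (count_in S l)) = q * pr n (\<lambda>l. R (Suc (count_in S l))) + (1 - q) * pr n (\<lambda>l. R (count_in S l))"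
proof -
  have "pr (Suc n) (\<lambda>l. R (count_in S l))
      = (\<integral>x. q * of_bool (R (Suc (count_in S (cells c n x)))) + (1 - q) * of_bool (R (count_in S (cells c n x)))
          \<partial>PiM {..<n} (\<lambda>_. M))"
    unfolding pr_Suc
  proof (rule Bochner_Integration.integral_cong[OF refl])
    fix x
    have "(\<integral>u. of_bool (R (count_in S (cells c n x @ [c u]))) \<partial>M)
        = (\<integral>u. (if c u \<in> S then of_bool (R (Suc (count_in S (cells c n x)))) :: real
             else of_bool (R (count_in S (cells c n x)))) \<partial>M)"
      by (intro Bochner_Integration.integral_cong) auto
    then show "(\<integral>u. of_bool (R (count_in S (cells c n x @ [c u]))) \<partial>M)
      = q * of_bool (R (Suc (count_in S (cells c n x)))) + (1 - q) * of_bool (R (count_in S (cells c n x)))"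
      using integral_two_valued by simp
  qed
  also have "\<dots> = q * pr n (\<lambda>l. R (Suc (count_in S l))) + (1 - q) * pr n (\<lambda>l. R (count_in S l))"
    unfolding pr_def
    using integrable_pr[of n "\<lambda>l. R (Suc (count_in S l))"] integrable_pr[of n "\<lambda>l. R (count_in S l)"]
    by simp
  finally show ?thesis .
qed

lemma pr_count_eq: "pr n (\<lambda>l. count_in S l = j) = Bernstein n j q"
proof (induction n arbitrary: j)
  case 0
  interpret P0: prob_space "PiM {..<0::nat} (\<lambda>_. M)" by (intro prob_space_PiM prob_space_axioms)
  show ?case using P0.prob_space
    by (cases j) (auto simp: pr_def cells_def count_in_def Bernstein_def)
next
  case (Suc n)
  show ?case
  proof (cases j)
    case 0
    then show ?thesis
      using pr_count_Suc[of n "\<lambda>k. k = j"] Suc[of 0] by (simp add: Bernstein_Suc_0 pr_def)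
  next
    case (Suc i)
    then show ?thesis
      using pr_count_Suc[of n "\<lambda>k. k = j"] Suc.IH[of i] Suc.IH[of "Suc i"] by (simp add: Bernstein_Suc_Suc)
  qed
qed

text \<open>One more trial matters only if it is a hit and the first \<open>n\<close> trials gave
  exactly \<open>j\<close> hits. This is the source of the gap between the two experiments.\<close>

lemma pr_count_gt_Suc: "pr (Suc n) (\<lambda>l. j < count_in S l) = pr n (\<lambda>l. j < count_in S l) + q * Bernstein n j q"
proof -
  have "pr n (\<lambda>l. j < Suc (count_in S l))
      = (\<integral>x. of_bool (j < count_in S (cells c n x)) + of_bool (count_in S (cells c n x) = j) \<partial>PiM {..<n} (\<lambda>_. M))"
    unfolding pr_def by (intro Bochner_Integration.integral_cong) auto
  also have "\<dots> = pr n (\<lambda>l. j < count_in S l) + pr n (\<lambda>l. count_in S l = j)"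
    unfolding pr_def using integrable_pr[of n "\<lambda>l. j < count_in S l"] integrable_pr[of n "\<lambda>l. count_in S l = j"]
    by simp
  finally have e: "pr n (\<lambda>l. j < Suc (count_in S l)) = pr n (\<lambda>l. j < count_in S l) + Bernstein n j q"
    by (simp add: pr_count_eq)
  show ?thesis
    unfolding pr_count_Suc[of n "\<lambda>k. j < k"] e by (simp add: algebra_simps)
qed

text \<open>The two counts differ only if some selected cell is observed twice. By the union bound,
  observation number \<open>n + 1\<close> repeats an earlier selected cell with probability at most
  \<open>n * \<delta>\<close>, and these bounds are summed.\<close>

lemma pr_collision:
  assumes d: "\<And>t. t \<in> S \<Longrightarrow> prob {u \<in> space M. c u = t} \<le> \<delta>" and d0: "0 \<le> \<delta>"
  shows "pr n (\<lambda>l. card (set l \<inter> S) \<noteq> count_in S l) \<le> (real n)\<^sup>2 * \<delta>"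
proof (induction n)
  case 0
  show ?case by (simp add: pr_def cells_def count_in_def)
next
  case (Suc n)
  let ?Q = "\<lambda>l. card (set l \<inter> S) \<noteq> count_in S l"
  interpret Pn: prob_space "PiM {..<n} (\<lambda>_. M)" by (intro prob_space_PiM prob_space_axioms)
  have hit: "prob {u \<in> space M. c u \<in> set l \<inter> S} \<le> real n * \<delta>" if "length l = n" for l
  proof -
    have "{u \<in> space M. c u \<in> set l \<inter> S} = (\<Union>t\<in>set l \<inter> S. {u \<in> space M. c u = t})" by auto
    also have "prob \<dots> \<le> (\<Sum>t\<in>set l \<inter> S. prob {u \<in> space M. c u = t})"
      by (intro finite_measure_subadditive_finite) auto
    also have "\<dots> \<le> (\<Sum>t\<in>set l \<inter> S. \<delta>)" using d by (intro sum_mono) auto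
    also have "\<dots> \<le> real n * \<delta>"
    proof -
      have "card (set l \<inter> S) \<le> n" using that
        by (metis List.finite_set card_length card_mono inf_le1 order_trans)
      then show ?thesis using d0 by (simp add: mult_right_mono)
    qed
    finally show ?thesis .
  qed
  have "pr (Suc n) ?Q \<le> (\<integral>x. of_bool (?Q (cells c n x)) + real n * \<delta> \<partial>PiM {..<n} (\<lambda>_. M))"
    unfolding pr_Suc
  proof (rule integral_mono')
    show "integrable (PiM {..<n} (\<lambda>_. M)) (\<lambda>x. of_bool (?Q (cells c n x)) + real n * \<delta>)"
      using integrable_pr[of n ?Q] by simp
    fix x
    let ?l = "cells c n x"
    have i: "integrable M (\<lambda>u. of_bool (?Q (?l @ [c u])) :: real)"
    proof (rule integrable_const_bound[of _ 1])
      show "(\<lambda>u. of_bool (?Q (?l @ [c u])) :: real) \<in> borel_measurable M"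
        by (rule measurable_compose[OF c]) simp
    qed auto
    have "(\<integral>u. (of_bool (?Q (?l @ [c u])) :: real) \<partial>M) \<le> (\<integral>u. of_bool (?Q ?l) + of_bool (c u \<in> set ?l \<inter> S) \<partial>M)"
    proof (rule integral_mono[OF i])
      show "integrable M (\<lambda>u. of_bool (?Q ?l) + of_bool (c u \<in> set ?l \<inter> S) :: real)"
        using integrable_of_bool_cell[of "set ?l \<inter> S"] by simp
      fix u
      \<comment> \<open>With no earlier repetition and no new one, a selected new cell raises both
        counts by one, and any other cell raises neither.\<close>
      have disj: "?Q ?l \<or> c u \<in> set ?l \<inter> S" if q: "?Q (?l @ [c u])"
      proof (rule ccontr)
        assume "\<not> ?thesis"
        then have *: "card (set ?l \<inter> S) = count_in S ?l" "c u \<in> S \<Longrightarrow> c u \<notin> set ?l" by auto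
        have "card (set (?l @ [c u]) \<inter> S) = card (set ?l \<inter> S) + of_bool (c u \<in> S)"
          using *(2) by (cases "c u \<in> S") auto
        then show False using q *(1) by simp
      qed
      show "(of_bool (?Q (?l @ [c u])) :: real) \<le> of_bool (?Q ?l) + of_bool (c u \<in> set ?l \<inter> S)"
        by (rule of_bool_le_add[OF disj])
    qed
    also have "\<dots> = of_bool (?Q ?l) + prob {u \<in> space M. c u \<in> set ?l \<inter> S}"
      using integrable_of_bool_cell[of "set ?l \<inter> S"] integral_of_bool_cell[of "set ?l \<inter> S"]
      by (simp add: prob_space)
    also have "\<dots> \<le> of_bool (?Q ?l) + real n * \<delta>" using hit[of ?l] by simp
    finally show "(\<integral>u. of_bool (?Q (?l @ [c u])) \<partial>M) \<le> of_bool (?Q ?l) + real n * \<delta>" .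
  qed (use d0 in auto)
  also have "\<dots> = pr n ?Q + real n * \<delta>"
    unfolding pr_def using integrable_pr[of n ?Q] by (simp add: Pn.prob_space)
  also have "\<dots> \<le> (real n)\<^sup>2 * \<delta> + real n * \<delta>" using Suc by simp
  also have "\<dots> \<le> (real (Suc n))\<^sup>2 * \<delta>"
    using d0 by (simp add: power2_eq_square algebra_simps)
  finally show ?case .
qed

end

section \<open>A lower bound for the largest binomial probability\<close>

lemma Bernstein_variance: "(\<Sum>k\<le>n. (real k - real n * y)\<^sup>2 * Bernstein n k y) = real n * y * (1 - y)"
proof -
  \<comment> \<open>The square is split into multiples of k(k-1), k and 1, whose binomial moments
    are known.\<close>
  have "(real k - real n * y)\<^sup>2 * Bernstein n k y
      = real k * (real k - 1) * Bernstein n k y + (1 - 2 * real n * y) * (real k * Bernstein n k y)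
        + (real n * y)\<^sup>2 * Bernstein n k y" for k
    by (simp add: power2_eq_square algebra_simps)
  then have "(\<Sum>k\<le>n. (real k - real n * y)\<^sup>2 * Bernstein n k y)
      = real n * (real n - 1) * y\<^sup>2 + (1 - 2 * real n * y) * (real n * y) + (real n * y)\<^sup>2"
    by (simp add: sum.distrib sum_distrib_left[symmetric])
  then show ?thesis by (simp add: power2_eq_square algebra_simps)
qed

text \<open>These integers lie between their minimum and their maximum, which differ by at most
  \<open>2 * h\<close>.\<close>

lemma card_nat_near:
  assumes "0 \<le> h"
  shows "real (card {k::nat. k \<le> n \<and> \<bar>real k - a\<bar> \<le> h}) \<le> 2 * h + 1"
proof (cases "{k::nat. k \<le> n \<and> \<bar>real k - a\<bar> \<le> h} = {}")
  case True
  then show ?thesis using assms by (simp only: True) simp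
next
  case False
  let ?J = "{k::nat. k \<le> n \<and> \<bar>real k - a\<bar> \<le> h}"
  have fin: "finite ?J" by simp
  have "?J \<subseteq> {Min ?J..Max ?J}" using fin by auto
  then have "card ?J \<le> Suc (Max ?J) - Min ?J" using card_mono[of "{Min ?J..Max ?J}" ?J] by simp
  moreover have m: "Min ?J \<in> ?J" "Max ?J \<in> ?J" using Min_in[OF fin False] Max_in[OF fin False] by blast+
  moreover have "Min ?J \<le> Max ?J" using m fin by simp
  ultimately have "real (card ?J) \<le> real (Max ?J) - real (Min ?J) + 1" by linarith
  moreover have "\<bar>real (Min ?J) - a\<bar> \<le> h" "\<bar>real (Max ?J) - a\<bar> \<le> h" using m by blast+
  ultimately show ?thesis by linarith
qed

text \<open>Chebyshev's inequality puts mass \<open>1/2\<close> on at most \<open>sqrt 2 * sqrt n + 1\<close> integers.\<close>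

lemma Bernstein_mode:
  assumes n: "0 < n" and y: "0 \<le> y" "y \<le> 1"
  obtains j where "1 / (2 * (sqrt 2 * sqrt (real n) + 1)) \<le> Bernstein n j y"
proof -
  \<comment> \<open>The variance is at most n/4, so at this distance Chebyshev's inequality leaves
    mass at most 1/2 outside.\<close>
  define h where "h = sqrt (real n / 2)"
  define J where "J = {k::nat. k \<le> n \<and> \<bar>real k - real n * y\<bar> \<le> h}"
  define m where "m = sqrt 2 * sqrt (real n) + 1"
  have h: "0 < h" "h\<^sup>2 = real n / 2" using n by (auto simp: h_def)
  have nn: "0 \<le> Bernstein n k y" for k using y by (rule Bernstein_nonneg)
  have "(\<Sum>k\<in>{..n} - J. Bernstein n k y) \<le> (\<Sum>k\<in>{..n} - J. (real k - real n * y)\<^sup>2 * Bernstein n k y / h\<^sup>2)"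
  proof (rule sum_mono)
    fix k assume "k \<in> {..n} - J"
    then have "h < \<bar>real k - real n * y\<bar>" by (auto simp: J_def)
    then have "h\<^sup>2 \<le> (real k - real n * y)\<^sup>2" using h(1) by (metis abs_le_square_iff abs_of_pos less_imp_le)
    then have "h\<^sup>2 * Bernstein n k y \<le> (real k - real n * y)\<^sup>2 * Bernstein n k y" using nn by (rule mult_right_mono)
    then show "Bernstein n k y \<le> (real k - real n * y)\<^sup>2 * Bernstein n k y / h\<^sup>2"
      using h(1) by (simp add: field_simps)
  qed
  also have "\<dots> \<le> (\<Sum>k\<le>n. (real k - real n * y)\<^sup>2 * Bernstein n k y / h\<^sup>2)"
    using nn by (intro sum_mono2) auto
  also have "\<dots> = real n * y * (1 - y) / (real n / 2)"
    unfolding sum_divide_distrib[symmetric] Bernstein_variance h(2) ..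
  also have "\<dots> = 2 * (y * (1 - y))" using n by simp
  also have "\<dots> \<le> 1 / 2"
  proof -
    have "0 \<le> (2 * y - 1)\<^sup>2" by simp
    then show ?thesis by (simp add: power2_eq_square algebra_simps)
  qed
  finally have out: "(\<Sum>k\<in>{..n} - J. Bernstein n k y) \<le> 1 / 2" .
  have "(\<Sum>k\<le>n. Bernstein n k y) = (\<Sum>k\<in>J. Bernstein n k y) + (\<Sum>k\<in>{..n} - J. Bernstein n k y)"
    by (subst add.commute, rule sum.subset_diff) (auto simp: J_def)
  then have inJ: "1 / 2 \<le> (\<Sum>k\<in>J. Bernstein n k y)" using out by simp
  have "2 * h = sqrt 2 * sqrt (real n)"
    by (simp add: h_def real_sqrt_divide field_simps)
  then have cJ: "real (card J) \<le> m"
    using card_nat_near[of h n "real n * y"] h by (simp add: J_def m_def)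
  have m0: "0 < m" by (simp add: m_def add_nonneg_pos)
  \<comment> \<open>Pigeonhole: at most \<open>m\<close> integers share a mass of at least
    1/2.\<close>
  have "\<exists>j. 1 / (2 * m) \<le> Bernstein n j y"
  proof (rule ccontr)
    assume "\<not> ?thesis"
    then have lt: "Bernstein n j y < 1 / (2 * m)" for j by (simp add: not_le)
    have "J \<noteq> {}" using inJ by auto
    then have "(\<Sum>k\<in>J. Bernstein n k y) < (\<Sum>k\<in>J. 1 / (2 * m))"
      using lt by (intro sum_strict_mono) (auto simp: J_def)
    also have "\<dots> = real (card J) / (2 * m)" by simp
    also have "\<dots> \<le> m / (2 * m)" using cJ m0 by (intro divide_right_mono) auto
    also have "\<dots> = 1 / 2" using m0 by simp
    finally show False using inJ by simp
  qed
  then show ?thesis using that by (auto simp: m_def)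
qed

section \<open>Selected cells and unobserved cells\<close>

text \<open>
  Block \<open>b\<close> consists of the cells \<open>b * m + j\<close> with \<open>j < m\<close>; a selector picks one cell in each of
  the \<open>m\<close> blocks.
\<close>

definition selectors :: "nat \<Rightarrow> (nat \<Rightarrow> nat) set" where
  "selectors m = {..<m} \<rightarrow>\<^sub>E {..<m}"

definition selected :: "nat \<Rightarrow> (nat \<Rightarrow> nat) \<Rightarrow> nat set" where
  "selected m \<sigma> = {t. t div m < m \<and> t mod m = \<sigma> (t div m)}"

lemma finite_selectors [simp]: "finite (selectors m)"
  by (simp add: selectors_def finite_PiE)

lemma selectors_nonempty: "selectors m \<noteq> {}"
  by (auto simp: selectors_def PiE_eq_empty_iff)

lemma selected_eq_image:
  assumes "\<sigma> \<in> selectors m"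
  shows "selected m \<sigma> = (\<lambda>b. b * m + \<sigma> b) ` {..<m}"
proof -
  have "\<sigma> b < m" if "b < m" for b using assms that by (auto simp: selectors_def)
  then have "b * m + \<sigma> b \<in> selected m \<sigma>" if "b < m" for b using that by (simp add: selected_def)
  moreover have "\<exists>b<m. t = b * m + \<sigma> b" if "t \<in> selected m \<sigma>" for t
    using that by (intro exI[of _ "t div m"]) (simp add: selected_def, metis div_mult_mod_eq)
  ultimately show ?thesis by blast
qed

lemma card_selected:
  assumes "\<sigma> \<in> selectors m"
  shows "card (selected m \<sigma>) = m"
proof -
  have s: "\<sigma> b < m" if "b < m" for b using assms that by (auto simp: selectors_def)
  have "inj_on (\<lambda>b. b * m + \<sigma> b) {..<m}"
  proof (rule inj_onI)
    fix b b' assume b: "b \<in> {..<m}" "b' \<in> {..<m}" and e: "b * m + \<sigma> b = b' * m + \<sigma> b'"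
    have "(b * m + \<sigma> b) div m = b" if "b < m" for b using s[OF that] by simp
    then show "b = b'" using b e by (metis lessThan_iff)
  qed
  then show ?thesis by (simp add: selected_eq_image[OF assms] card_image)
qed

lemma selected_less:
  assumes "t \<in> selected m \<sigma>" "0 < m"
  shows "t < m * m"
  using assms by (auto simp: selected_def div_less_iff_less_mult)

text \<open>The likelihood of observing the cells \<open>l\<close>, relative to uniform sampling,
  under a density equal to \<open>\<alpha>\<close> off \<open>S\<close> and to
  \<open>\<alpha> + \<beta>\<close> on \<open>S\<close>.\<close>

definition list_weight :: "real \<Rightarrow> real \<Rightarrow> nat set \<Rightarrow> nat list \<Rightarrow> real" where
  "list_weight \<alpha> \<beta> S l = (\<Prod>t\<leftarrow>l. \<alpha> + \<beta> * of_bool (t \<in> S))"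

lemma list_weight_nonneg: "0 \<le> \<alpha> \<Longrightarrow> 0 \<le> \<beta> \<Longrightarrow> 0 \<le> list_weight \<alpha> \<beta> S l"
  unfolding list_weight_def by (rule prod_list_nonneg) auto

lemma list_weight_mono:
  assumes "0 \<le> \<alpha>" "0 \<le> \<beta>" "set l \<inter> S \<subseteq> S'"
  shows "list_weight \<alpha> \<beta> S l \<le> list_weight \<alpha> \<beta> S' l"
  using assms(3)
proof (induction l)
  case (Cons t l)
  have "(\<alpha> + \<beta> * of_bool (t \<in> S)) * list_weight \<alpha> \<beta> S l
      \<le> (\<alpha> + \<beta> * of_bool (t \<in> S')) * list_weight \<alpha> \<beta> S' l"
    using Cons assms(1,2) by (intro mult_mono list_weight_nonneg) auto
  then show ?case by (simp add: list_weight_def)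
qed (simp add: list_weight_def)

text \<open>
  If \<open>t\<close> is not observed, moving the selected cell of its block from \<open>t\<close> to any other cell of the
  block does not decrease the likelihood, so under the uniform prior the posterior probability
  that \<open>t\<close> is selected is at most \<open>1 / m\<close>.
\<close>

lemma posterior_unseen:
  assumes ab: "0 \<le> \<alpha>" "0 \<le> \<beta>" and t: "t \<notin> set l"
  shows "real m * (\<Sum>\<sigma>\<in>selectors m. of_bool (t \<in> selected m \<sigma>) * list_weight \<alpha> \<beta> (selected m \<sigma>) l)
       \<le> (\<Sum>\<sigma>\<in>selectors m. list_weight \<alpha> \<beta> (selected m \<sigma>) l)"
proof (cases "t div m < m")
  case False
  then show ?thesis
    using ab by (simp add: selected_def sum_nonneg list_weight_nonneg)
next
  case True
  define b where "b = t div m"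
  define W where "W = (\<lambda>\<sigma>. list_weight \<alpha> \<beta> (selected m \<sigma>) l)"
  define T where "T = {\<sigma> \<in> selectors m. \<sigma> b = t mod m}"
  have m0: "0 < m" and b: "b < m" using True by (auto simp: b_def)
  have tT: "t \<in> selected m \<sigma> \<longleftrightarrow> \<sigma> b = t mod m" for \<sigma>
    using True by (auto simp: selected_def b_def)
  \<comment> \<open>An observed cell of block \<open>b\<close> that \<open>\<sigma>\<close> selects
    would be \<open>t\<close> itself. So there is none, and moving the choice in that block loses no
    observed hit.\<close>
  have upd: "W \<sigma> \<le> W (\<sigma>(b := j))" if "\<sigma> \<in> T" for \<sigma> j
    unfolding W_def
  proof (intro list_weight_mono ab subsetI)
    fix u assume u: "u \<in> set l \<inter> selected m \<sigma>"
    have "u div m \<noteq> b"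
    proof
      assume e: "u div m = b"
      then have "u mod m = t mod m" using u that by (auto simp: selected_def T_def)
      then have "u = t" using e by (metis b_def div_mult_mod_eq)
      then show False using u t by auto
    qed
    then show "u \<in> selected m (\<sigma>(b := j))" using u by (auto simp: selected_def)
  qed
  have "real m * (\<Sum>\<sigma>\<in>selectors m. of_bool (t \<in> selected m \<sigma>) * W \<sigma>) = real m * (\<Sum>\<sigma>\<in>T. W \<sigma>)"
    by (simp add: tT T_def sum.If_cases of_bool_def if_distrib[of "\<lambda>z. z * _"] Int_def cong: if_cong)
  also have "\<dots> = (\<Sum>\<sigma>\<in>T. \<Sum>j<m. W \<sigma>)" by (simp add: sum_distrib_left)
  also have "\<dots> \<le> (\<Sum>\<sigma>\<in>T. \<Sum>j<m. W (\<sigma>(b := j)))" by (intro sum_mono upd)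
  also have "\<dots> = (\<Sum>(\<sigma>, j)\<in>T \<times> {..<m}. W (\<sigma>(b := j)))" by (simp add: sum.cartesian_product)
  \<comment> \<open>Every selector arises exactly once: its value at \<open>b\<close> is the
    \<open>j\<close> of the pair, and resetting that value to \<open>t mod m\<close> gives the
    element of \<open>T\<close>.\<close>
  also have "\<dots> = (\<Sum>\<sigma>\<in>selectors m. W \<sigma>)"
    by (rule sum.reindex_bij_witness[where i = "\<lambda>\<sigma>. (\<sigma>(b := t mod m), \<sigma> b)" and j = "\<lambda>(\<sigma>, j). \<sigma>(b := j)"])
      (use b m0 in \<open>auto simp: T_def selectors_def PiE_def Pi_def extensional_def fun_upd_idem_iff\<close>)
  finally show ?thesis by (simp add: W_def)
qed

text \<open>Linearity of the posterior expectation: each of the at most \<open>N\<close> unobserved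
  candidates contributes at most a share 1/m of the total weight.\<close>

lemma posterior_unseen_set:
  assumes ab: "0 \<le> \<alpha>" "0 \<le> \<beta>" and m: "0 < m" and T: "finite T" "card T \<le> N"
  shows "(\<Sum>\<sigma>\<in>selectors m. real (card ((T - set l) \<inter> selected m \<sigma>)) * list_weight \<alpha> \<beta> (selected m \<sigma>) l)
       \<le> real N / real m * (\<Sum>\<sigma>\<in>selectors m. list_weight \<alpha> \<beta> (selected m \<sigma>) l)"
proof -
  define W where "W = (\<lambda>\<sigma>. list_weight \<alpha> \<beta> (selected m \<sigma>) l)"
  have W0: "0 \<le> W \<sigma>" for \<sigma> unfolding W_def using ab by (rule list_weight_nonneg)
  have card: "real (card ((T - set l) \<inter> selected m \<sigma>)) = (\<Sum>t\<in>T - set l. of_bool (t \<in> selected m \<sigma>))" for \<sigma>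
    using T(1) by (simp add: of_bool_def sum.If_cases Int_def)
  have "(\<Sum>\<sigma>\<in>selectors m. real (card ((T - set l) \<inter> selected m \<sigma>)) * W \<sigma>)
      = (\<Sum>t\<in>T - set l. \<Sum>\<sigma>\<in>selectors m. of_bool (t \<in> selected m \<sigma>) * W \<sigma>)"
    unfolding card sum_distrib_right by (rule sum.swap)
  also have "\<dots> \<le> (\<Sum>t\<in>T - set l. (\<Sum>\<sigma>\<in>selectors m. W \<sigma>) / real m)"
  proof (rule sum_mono)
    fix t assume "t \<in> T - set l"
    then have "real m * (\<Sum>\<sigma>\<in>selectors m. of_bool (t \<in> selected m \<sigma>) * W \<sigma>) \<le> (\<Sum>\<sigma>\<in>selectors m. W \<sigma>)"
      unfolding W_def using ab by (intro posterior_unseen) auto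
    then show "(\<Sum>\<sigma>\<in>selectors m. of_bool (t \<in> selected m \<sigma>) * W \<sigma>) \<le> (\<Sum>\<sigma>\<in>selectors m. W \<sigma>) / real m"
      using m by (simp add: pos_le_divide_eq mult.commute)
  qed
  also have "\<dots> = real (card (T - set l)) * ((\<Sum>\<sigma>\<in>selectors m. W \<sigma>) / real m)" by simp
  also have "\<dots> \<le> real N * ((\<Sum>\<sigma>\<in>selectors m. W \<sigma>) / real m)"
  proof (intro mult_right_mono divide_nonneg_nonneg sum_nonneg W0)
    have "card (T - set l) \<le> card T" using T(1) by (intro card_mono) auto
    then show "real (card (T - set l)) \<le> real N" using T(2) by simp
  qed simp
  finally show ?thesis by (simp add: W_def)
qed

text \<open>A named selected cell is either observed, and then accounts for at least one hit, or
  unobserved.\<close>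

lemma card_inter_le_count:
  assumes "finite T"
  shows "card (T \<inter> S) \<le> count_in S l + card ((T - set l) \<inter> S)"
proof -
  have "card (T \<inter> S) \<le> card (set (filter (\<lambda>t. t \<in> S) l) \<union> ((T - set l) \<inter> S))"
    using assms by (intro card_mono) auto
  also have "\<dots> \<le> card (set (filter (\<lambda>t. t \<in> S) l)) + card ((T - set l) \<inter> S)" by (rule card_Un_le)
  also have "card (set (filter (\<lambda>t. t \<in> S) l)) \<le> count_in S l"
    unfolding count_in_def by (rule card_length)
  finally show ?thesis by simp
qed

text \<open>Success without more than \<open>j\<close> observed hits needs a right guess among the
  unobserved cells. That event is charged by the number of right guesses, which
  \<open>posterior_unseen_set\<close> controls on average.\<close>

lemma of_bool_hits_le:
  assumes "finite T"
  shows "(of_bool (j < card (T \<inter> S)) :: real) \<le> of_bool (j < count_in S l) + real (card ((T - set l) \<inter> S))"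
  using card_inter_le_count[OF assms, of S l] by (auto simp: of_bool_def)

section \<open>The spiked densities\<close>

text \<open>For positive \<open>m\<close> the cells are half-open intervals of length 1/m^2. The end
  point 1 alone gets the extra index \<open>m * m\<close>, which is never selected.\<close>

definition cell :: "nat \<Rightarrow> real \<Rightarrow> nat" where
  "cell m x = nat \<lfloor>real (m * m) * x\<rfloor>"

lemma cell_measurable: "cell m \<in> unit_lebesgue \<rightarrow>\<^sub>M count_space UNIV"
proof -
  have "(\<lambda>x::real. nat \<lfloor>real (m * m) * x\<rfloor>) \<in> borel \<rightarrow>\<^sub>M count_space UNIV" by measurable
  then have "cell m \<in> lborel \<rightarrow>\<^sub>M count_space UNIV" by (simp add: cell_def[abs_def])
  then show ?thesis unfolding unit_lebesgue_def by (rule measurable_restrict_space1)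
qed

lemma cell_grid: "0 < m \<Longrightarrow> cell m (real t / real (m * m)) = t"
  by (simp add: cell_def)

lemma measure_cell_eq:
  assumes m: "0 < m" and t: "t < m * m"
  shows "measure unit_lebesgue {x \<in> {0..1}. cell m x = t} = 1 / real (m * m)"
proof -
  let ?N = "real (m * m)"
  have N: "0 < ?N" using m by simp
  have "{x \<in> {0..1}. cell m x = t} = {real t / ?N..<(real t + 1) / ?N}"
  proof (intro set_eqI iffI)
    fix x assume "x \<in> {x \<in> {0..1}. cell m x = t}"
    then have x: "0 \<le> x" "x \<le> 1" "nat \<lfloor>?N * x\<rfloor> = t" by (auto simp: cell_def)
    then have "\<lfloor>?N * x\<rfloor> = int t" using N by (metis mult_nonneg_nonneg less_imp_le nat_eq_iff zero_le_floor)
    then have "real t \<le> ?N * x" "?N * x < real t + 1" by linarith+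
    then show "x \<in> {real t / ?N..<(real t + 1) / ?N}" using N by (simp add: divide_le_eq less_divide_eq mult.commute)
  next
    fix x assume "x \<in> {real t / ?N..<(real t + 1) / ?N}"
    then have x: "real t \<le> ?N * x" "?N * x < real t + 1" using N by (simp_all add: divide_le_eq less_divide_eq mult.commute)
    then have "\<lfloor>?N * x\<rfloor> = int t" by linarith
    moreover have "0 \<le> x" using x(1) N by (metis mult.commute of_nat_0_le_iff order_trans zero_le_mult_iff not_le)
    moreover have "x \<le> 1"
    proof -
      have "real t + 1 \<le> ?N" using t by (metis Suc_leI of_nat_Suc of_nat_le_iff add.commute)
      then have "?N * x \<le> ?N * 1" using x(2) by linarith
      then show ?thesis using N by (metis mult_le_cancel_left_pos)
    qed
    ultimately show "x \<in> {x \<in> {0..1}. cell m x = t}" by (simp add: cell_def)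
  qed
  moreover have sub: "{real t / ?N..<(real t + 1) / ?N} \<subseteq> {0..1}"
    using calculation by blast
  moreover have "measure unit_lebesgue {real t / ?N..<(real t + 1) / ?N} = measure lborel {real t / ?N..<(real t + 1) / ?N}"
    unfolding unit_lebesgue_def using sub by (intro measure_restrict_space) auto
  moreover have "measure lborel {real t / ?N..<(real t + 1) / ?N} = 1 / ?N"
    using N by (simp add: divide_right_mono add_divide_distrib)
  ultimately show ?thesis by simp
qed

lemma cell_set_measurable: "{x \<in> {0..1}. cell m x \<in> B} \<in> sets unit_lebesgue"
  using measurable_sets[OF cell_measurable, of B m] by (simp add: vimage_def Int_def conj_commute)

lemma cell_set_Int:
  "{x. 0 \<le> x \<and> x \<le> 1 \<and> cell m x \<in> B} \<inter> {0..1} = {x. 0 \<le> x \<and> x \<le> 1 \<and> cell m x \<in> B}"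
  by auto

lemma measure_cell_in:
  assumes m: "0 < m" and B: "B \<subseteq> {..<m * m}"
  shows "measure unit_lebesgue {x \<in> {0..1}. cell m x \<in> B} = real (card B) / real (m * m)"
proof -
  interpret U: prob_space unit_lebesgue by (rule prob_space_unit_lebesgue)
  have fin: "finite B" using B finite_subset by blast
  have "{x \<in> {0..1}. cell m x \<in> B} = (\<Union>t\<in>B. {x \<in> {0..1}. cell m x = t})" by auto
  also have "measure unit_lebesgue \<dots> = (\<Sum>t\<in>B. measure unit_lebesgue {x \<in> {0..1}. cell m x = t})"
    using fin cell_set_measurable[of m "{_}"]
    by (intro U.finite_measure_finite_Union) (auto simp: disjoint_family_on_def)
  also have "\<dots> = (\<Sum>t\<in>B. 1 / real (m * m))"
    using B by (intro sum.cong refl measure_cell_eq[OF m]) auto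
  finally show ?thesis by simp
qed

text \<open>The \<open>m\<close> selected cells have total length 1/m, so the spikes of height
  \<open>(1 - 1 / r) * m\<close> add exactly the mass that the constant 1/r leaves over. The
  restriction makes the function extensional, as \<open>densities\<close> demands.\<close>

definition spiked :: "real \<Rightarrow> nat \<Rightarrow> (nat \<Rightarrow> nat) \<Rightarrow> real \<Rightarrow> real" where
  "spiked r m \<sigma> = (\<lambda>x\<in>{0..1}. 1 / r + (1 - 1 / r) * real m * of_bool (cell m x \<in> selected m \<sigma>))"

lemma spiked_measurable: "spiked r m \<sigma> \<in> borel_measurable unit_lebesgue"
proof -
  have "(\<lambda>x. 1 / r + (1 - 1 / r) * real m * of_bool (cell m x \<in> selected m \<sigma>)) \<in> borel_measurable unit_lebesgue"
    by (rule measurable_compose[OF cell_measurable]) simp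
  then show ?thesis by (rule measurable_cong[THEN iffD1, rotated]) (simp add: spiked_def)
qed

lemma spiked_lower:
  assumes "1 < r" "x \<in> {0..1}"
  shows "1 / r \<le> spiked r m \<sigma> x"
proof -
  have "0 \<le> 1 - 1 / r" using assms(1) by simp
  then show ?thesis using assms(2) by (simp add: spiked_def)
qed

lemma integral_spiked_indicator:
  assumes r: "1 < r" and m: "0 < m" and \<sigma>: "\<sigma> \<in> selectors m" and B: "B \<subseteq> selected m \<sigma>"
  shows "(\<integral>x. spiked r m \<sigma> x * of_bool (cell m x \<in> B) \<partial>unit_lebesgue)
       = (1 / r + (1 - 1 / r) * real m) * (real (card B) / real (m * m))"
proof -
  have BN: "B \<subseteq> {..<m * m}" using B m by (auto dest: selected_less)
  have "(\<integral>x. spiked r m \<sigma> x * of_bool (cell m x \<in> B) \<partial>unit_lebesgue)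
      = (\<integral>x. (1 / r + (1 - 1 / r) * real m) * indicator {x \<in> {0..1}. cell m x \<in> B} x \<partial>unit_lebesgue)"
    using B by (intro Bochner_Integration.integral_cong) (auto simp: spiked_def indicator_def)
  also have "\<dots> = (1 / r + (1 - 1 / r) * real m) * measure unit_lebesgue {x \<in> {0..1}. cell m x \<in> B}"
    using cell_set_measurable[of m B] by (simp add: cell_set_Int)
  finally show ?thesis using measure_cell_in[OF m BN] by simp
qed

lemma spiked_density:
  assumes r: "1 < r" and m: "0 < m" and \<sigma>: "\<sigma> \<in> selectors m"
  shows "spiked r m \<sigma> \<in> densities r"
proof -
  interpret U: prob_space unit_lebesgue by (rule prob_space_unit_lebesgue)
  have S: "selected m \<sigma> \<subseteq> {..<m * m}" using m by (auto dest: selected_less)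
  have "(\<integral>x. spiked r m \<sigma> x \<partial>unit_lebesgue)
      = (\<integral>x. 1 / r + (1 - 1 / r) * real m * indicator {x \<in> {0..1}. cell m x \<in> selected m \<sigma>} x \<partial>unit_lebesgue)"
    by (intro Bochner_Integration.integral_cong) (auto simp: spiked_def)
  also have "\<dots> = 1 / r + (1 - 1 / r) * real m * measure unit_lebesgue {x \<in> {0..1}. cell m x \<in> selected m \<sigma>}"
    using cell_set_measurable[of m "selected m \<sigma>"]
    by (simp add: cell_set_Int U.prob_space[simplified] U.emeasure_eq_measure)
  also have "\<dots> = 1"
    using m measure_cell_in[OF m S] by (simp add: card_selected[OF \<sigma>])
  finally have "(\<integral>x. spiked r m \<sigma> x \<partial>unit_lebesgue) = 1" .
  moreover have "spiked r m \<sigma> \<in> extensional {0..1}" by (simp add: spiked_def)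
  ultimately show ?thesis
    using spiked_lower[OF r] by (simp add: densities_def spiked_measurable)
qed

text \<open>The value is 1/r < 1 off the selected cells, and \<open>1 / r + (1 - 1 / r) * m\<close>
  on them, which exceeds 1 as soon as \<open>m > 1\<close>.\<close>

lemma selected_recover:
  assumes r: "1 < r" and m: "1 < m"
  shows "{t \<in> {..<m * m}. 1 < spiked r m \<sigma> (real t / real (m * m))} = selected m \<sigma>"
proof -
  have m0: "0 < m" using m by simp
  have p: "0 < 1 - 1 / r" "1 / r < 1" using r by auto
  have "(1 - 1 / r) * 1 < (1 - 1 / r) * real m" using p m by (intro mult_strict_left_mono) auto
  then have big: "1 < 1 / r + (1 - 1 / r) * real m" by simp
  have "1 < spiked r m \<sigma> (real t / real (m * m)) \<longleftrightarrow> t \<in> selected m \<sigma>" if t: "t < m * m" for t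
  proof -
    have "real t / real (m * m) \<in> {0..1}" using t m0 by (simp add: divide_le_eq_1 flip: of_nat_mult)
    then have "spiked r m \<sigma> (real t / real (m * m)) = 1 / r + (1 - 1 / r) * real m * of_bool (t \<in> selected m \<sigma>)"
      by (simp only: spiked_def restrict_apply' cell_grid[OF m0])
    then show ?thesis using big p by (cases "t \<in> selected m \<sigma>") simp_all
  qed
  then show ?thesis using m0 by (auto dest: selected_less)
qed

text \<open>The constant part contributes 1/(r m) to the hit probability and the spikes contribute 1
  - 1/r. The total is split equally over \<open>m\<close> cells, which gives the bound 1/m that
  \<open>pr_collision\<close> needs.\<close>

lemma cell_sample_spiked:
  assumes r: "1 < r" and m: "0 < m" and \<sigma>: "\<sigma> \<in> selectors m"
  defines "P \<equiv> density unit_lebesgue (\<lambda>x. ennreal (spiked r m \<sigma> x))"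
  shows "cell_sample P (cell m) (selected m \<sigma>) ((1 / r + (1 - 1 / r) * real m) / real m)"
    and "t \<in> selected m \<sigma> \<Longrightarrow> measure P {u \<in> space P. cell m u = t} \<le> 1 / real m"
proof -
  have P: "prob_space P"
    unfolding P_def by (rule prob_space_density_experiment[OF _ spiked_density[OF r m \<sigma>]]) (use r in simp)
  interpret P: prob_space P by fact
  have c: "cell m \<in> P \<rightarrow>\<^sub>M count_space UNIV" using cell_measurable by (simp add: P_def)
  have meas: "measure P {u \<in> space P. cell m u \<in> B} = (1 / r + (1 - 1 / r) * real m) * (real (card B) / real (m * m))"
    if B: "B \<subseteq> selected m \<sigma>" for B
  proof -
    have "{u \<in> space P. cell m u \<in> B} \<in> sets P"
      using cell_set_measurable[of m B] by (simp add: P_def)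
    then have "measure P {u \<in> space P. cell m u \<in> B} = (\<integral>u. indicator {u \<in> space P. cell m u \<in> B} u \<partial>P)"
      by simp
    also have "\<dots> = (\<integral>u. of_bool (cell m u \<in> B) \<partial>P)"
      by (intro Bochner_Integration.integral_cong) (auto simp: indicator_def)
    also have "\<dots> = (\<integral>u. spiked r m \<sigma> u *\<^sub>R of_bool (cell m u \<in> B) \<partial>unit_lebesgue)"
      unfolding P_def
    proof (rule integral_density)
      show "(\<lambda>u. of_bool (cell m u \<in> B) :: real) \<in> borel_measurable unit_lebesgue"
        by (rule measurable_compose[OF cell_measurable]) simp
      show "AE x in unit_lebesgue. 0 \<le> spiked r m \<sigma> x"
      proof (rule AE_I2)
        fix x assume "x \<in> space unit_lebesgue"
        then have "1 / r \<le> spiked r m \<sigma> x" using spiked_lower[OF r] by simp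
        moreover have "0 < 1 / r" using r by simp
        ultimately show "0 \<le> spiked r m \<sigma> x" by linarith
      qed
    qed (rule spiked_measurable)
    finally show ?thesis using integral_spiked_indicator[OF r m \<sigma> B] by simp
  qed
  show "cell_sample P (cell m) (selected m \<sigma>) ((1 / r + (1 - 1 / r) * real m) / real m)"
  proof (intro cell_sample.intro cell_sample_axioms.intro P c)
    show "(1 / r + (1 - 1 / r) * real m) / real m = measure P {u \<in> space P. cell m u \<in> selected m \<sigma>}"
      using meas[of "selected m \<sigma>"] m by (simp add: card_selected[OF \<sigma>])
  qed
  assume t: "t \<in> selected m \<sigma>"
  have "measure P {u \<in> space P. cell m u = t} = (1 / r + (1 - 1 / r) * real m) * (1 / real (m * m))"
    using meas[of "{t}"] t by simp
  also have "\<dots> \<le> real m * (1 / real (m * m))"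
  proof (rule mult_right_mono)
    have "1 / r * 1 \<le> 1 / r * real m" using r m by (intro mult_left_mono) auto
    then show "1 / r + (1 - 1 / r) * real m \<le> real m" by (simp add: algebra_simps)
  qed simp
  finally show "measure P {u \<in> space P. cell m u = t} \<le> 1 / real m" using m by simp
qed

text \<open>The loss reads the selected cells off the density: they are the cells with left end value above 1.\<close>

definition cell_loss :: "nat \<Rightarrow> nat \<Rightarrow> nat \<Rightarrow> (real \<Rightarrow> real) \<Rightarrow> real" where
  "cell_loss m j a f =
     of_bool (\<not> j < card (set_decode a \<inter> {t \<in> {..<m * m}. 1 < f (real t / real (m * m))}))"

text \<open>Actions are natural numbers, so a set of named cells is represented by its binary
  code.\<close>

definition cell_actions :: "nat \<Rightarrow> nat \<Rightarrow> nat set" where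
  "cell_actions m n = set_encode ` {T. T \<subseteq> {..<m * m} \<and> card T \<le> n}"

lemma finite_cell_actions: "finite (cell_actions m n)"
  unfolding cell_actions_def by (rule finite_imageI, rule finite_subset[of _ "Pow {..<m * m}"]) auto

lemma cell_actions_decode:
  assumes "a \<in> cell_actions m n"
  shows "finite (set_decode a)" "card (set_decode a) \<le> n"
proof -
  obtain T where T: "T \<subseteq> {..<m * m}" "card T \<le> n" "a = set_encode T"
    using assms by (auto simp: cell_actions_def)
  then have "finite T" using finite_subset by blast
  then show "finite (set_decode a)" "card (set_decode a) \<le> n" using T by (simp_all add: set_encode_inverse)
qed

lemma cell_loss_spiked:
  assumes "1 < r" "1 < m"
  shows "cell_loss m j a (spiked r m \<sigma>) = of_bool (\<not> j < card (set_decode a \<inter> selected m \<sigma>))"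
  unfolding cell_loss_def selected_recover[OF assms] ..

text \<open>The deterministic strategy that names the observed cells; it succeeds when more than
  \<open>j\<close> distinct selected cells have been observed.\<close>

lemma report_cells_procedure:
  obtains \<rho> where "\<rho> \<in> decision_procedures (experiment_power (density_experiment r) n) (cell_actions m n)"
    and "\<And>\<sigma>. 1 < r \<Longrightarrow> 1 < m \<Longrightarrow> \<sigma> \<in> selectors m \<Longrightarrow>
      risk (experiment_power (density_experiment r) n) (cell_loss m j) \<rho> (spiked r m \<sigma>)
        = (\<integral>x. of_bool (\<not> j < card (set (cells (cell m) n x) \<inter> selected m \<sigma>))
             \<partial>PiM {..<n} (\<lambda>_. density unit_lebesgue (\<lambda>x. ennreal (spiked r m \<sigma> x))))"
proof
  let ?A = "cell_actions m n"
  \<comment> \<open>\<open>take n\<close> and the intersection make the action legal for every list.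
    On an actual sample the first changes nothing and the second removes no selected cell.\<close>
  let ?T = "\<lambda>l. set (take n l) \<inter> {..<m * m}"
  let ?\<rho> = "\<lambda>x. return (count_space ?A) (set_encode (?T (cells (cell m) n x)))"
  have TA: "set_encode (?T l) \<in> ?A" for l
  proof -
    have "card (?T l) \<le> card (set (take n l))" by (intro card_mono) auto
    also have "\<dots> \<le> n" by (metis card_length length_take min.cobounded2 order_trans)
    finally show ?thesis by (auto simp: cell_actions_def)
  qed
  have "(\<lambda>l. set_encode (?T l)) \<in> count_space UNIV \<rightarrow>\<^sub>M count_space ?A" using TA by simp
  then have "(\<lambda>l. return (count_space ?A) (set_encode (?T l))) \<in> count_space UNIV \<rightarrow>\<^sub>M prob_algebra (count_space ?A)"
    by (rule measurable_compose) (rule measurable_return_prob_space)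
  then have "?\<rho> \<in> PiM {..<n} (\<lambda>_. unit_lebesgue) \<rightarrow>\<^sub>M prob_algebra (count_space ?A)"
    by (rule measurable_compose[OF cells_measurable[OF cell_measurable]])
  then show "?\<rho> \<in> decision_procedures (experiment_power (density_experiment r) n) ?A"
    by (simp add: decision_procedures_def experiment_power_def density_experiment_def)
  fix \<sigma> assume r: "1 < r" and m: "1 < m" and \<sigma>: "\<sigma> \<in> selectors m"
  have "(\<integral>a. cell_loss m j a (spiked r m \<sigma>) \<partial>?\<rho> x)
      = of_bool (\<not> j < card (set (cells (cell m) n x) \<inter> selected m \<sigma>))" for x
  proof -
    have "(\<integral>a. cell_loss m j a (spiked r m \<sigma>) \<partial>?\<rho> x) = cell_loss m j (set_encode (?T (cells (cell m) n x))) (spiked r m \<sigma>)"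
      using TA[of "cells (cell m) n x"] by (intro integral_return) auto
    also have "\<dots> = of_bool (\<not> j < card (?T (cells (cell m) n x) \<inter> selected m \<sigma>))"
      by (simp add: cell_loss_spiked[OF r m] set_encode_inverse)
    also have "?T (cells (cell m) n x) \<inter> selected m \<sigma> = set (cells (cell m) n x) \<inter> selected m \<sigma>"
      using m by (auto dest: selected_less)
    finally show ?thesis .
  qed
  then show "risk (experiment_power (density_experiment r) n) (cell_loss m j) ?\<rho> (spiked r m \<sigma>)
        = (\<integral>x. of_bool (\<not> j < card (set (cells (cell m) n x) \<inter> selected m \<sigma>))
             \<partial>PiM {..<n} (\<lambda>_. density unit_lebesgue (\<lambda>x. ennreal (spiked r m \<sigma> x))))"
    by (simp add: risk_def experiment_power_def density_experiment_def)
qed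

section \<open>Comparing risks by averaging over the selectors\<close>

lemma spiked_likelihood:
  assumes x: "x \<in> space (PiM {..<n} (\<lambda>_. unit_lebesgue))"
  shows "(\<Prod>i<n. spiked r m \<sigma> (x i)) = list_weight (1 / r) ((1 - 1 / r) * real m) (selected m \<sigma>) (cells (cell m) n x)"
proof -
  have "list_weight (1 / r) ((1 - 1 / r) * real m) (selected m \<sigma>) (cells (cell m) n x)
      = (\<Prod>i\<leftarrow>[0..<n]. 1 / r + (1 - 1 / r) * real m * of_bool (cell m (x i) \<in> selected m \<sigma>))"
    by (simp add: list_weight_def cells_def o_def)
  also have "\<dots> = (\<Prod>i<n. 1 / r + (1 - 1 / r) * real m * of_bool (cell m (x i) \<in> selected m \<sigma>))"
    by (subst prod.distinct_set_conv_list[symmetric]) (auto simp: lessThan_atLeast0)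
  also have "\<dots> = (\<Prod>i<n. spiked r m \<sigma> (x i))"
  proof (rule prod.cong[OF refl])
    fix i assume "i \<in> {..<n}"
    then have "x i \<in> {0..1}" using PiM_coord_in_space[OF x] by simp
    then show "1 / r + (1 - 1 / r) * real m * of_bool (cell m (x i) \<in> selected m \<sigma>) = spiked r m \<sigma> (x i)"
      by (simp add: spiked_def)
  qed
  finally show ?thesis by simp
qed

text \<open>The mean number of right guesses among unobserved cells under the randomised action.
  \<open>x\<close> and \<open>l\<close> are separate because a procedure may use more of the sample
  than its cells.\<close>

definition unseen_hits :: "('x \<Rightarrow> nat measure) \<Rightarrow> nat set \<Rightarrow> nat set \<Rightarrow> nat list \<Rightarrow> 'x \<Rightarrow> real" where
  "unseen_hits \<rho> A S l x = (\<Sum>a\<in>A. measure (\<rho> x) {a} * real (card ((set_decode a - set l) \<inter> S)))"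

text \<open>For a fixed sample the action weights do not depend on \<open>\<sigma>\<close>, so the
  sums can be swapped and \<open>posterior_unseen_set\<close> applied to each action.\<close>

lemma unseen_hits_posterior:
  assumes "0 \<le> \<alpha>" "0 \<le> \<beta>" "0 < m"
    and A: "finite A" "\<And>a. a \<in> A \<Longrightarrow> finite (set_decode a) \<and> card (set_decode a) \<le> N"
    and mass: "(\<Sum>a\<in>A. measure (\<rho> x) {a}) = 1"
  shows "(\<Sum>\<sigma>\<in>selectors m. list_weight \<alpha> \<beta> (selected m \<sigma>) l * unseen_hits \<rho> A (selected m \<sigma>) l x)
       \<le> real N / real m * (\<Sum>\<sigma>\<in>selectors m. list_weight \<alpha> \<beta> (selected m \<sigma>) l)"
proof -
  let ?W = "\<lambda>\<sigma>. list_weight \<alpha> \<beta> (selected m \<sigma>) l"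
  let ?K = "real N / real m * (\<Sum>\<sigma>\<in>selectors m. ?W \<sigma>)"
  have "(\<Sum>\<sigma>\<in>selectors m. ?W \<sigma> * unseen_hits \<rho> A (selected m \<sigma>) l x)
      = (\<Sum>a\<in>A. measure (\<rho> x) {a} * (\<Sum>\<sigma>\<in>selectors m. real (card ((set_decode a - set l) \<inter> selected m \<sigma>)) * ?W \<sigma>))"
    unfolding unseen_hits_def sum_distrib_left
    by (subst sum.swap) (intro sum.cong refl, simp add: mult_ac)
  also have "\<dots> \<le> (\<Sum>a\<in>A. measure (\<rho> x) {a} * ?K)"
    using A(2) by (intro sum_mono mult_left_mono posterior_unseen_set assms(1-3)) auto
  also have "\<dots> = ?K" unfolding sum_distrib_right[symmetric] mass by simp
  finally show ?thesis .
qed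

text \<open>With \<open>n + 1\<close> observations, naming the observed cells succeeds, up to
  collisions, if the count exceeds \<open>j\<close>. With \<open>n\<close> observations any
  procedure needs such a count or a right guess. The two binomial probabilities differ by
  \<open>q * Bernstein n j q\<close>. Guesses may be good for particular selectors, so the
  inequality is averaged over all of them.\<close>

lemma spiked_separation:
  assumes r: "1 < r" and m: "1 < m"
    and dom: "\<And>\<rho>. \<rho> \<in> decision_procedures (experiment_power (density_experiment r) (n + 1)) (cell_actions m (n + 1)) \<Longrightarrow>
      \<exists>\<rho>'\<in>decision_procedures (experiment_power (density_experiment r) n) (cell_actions m (n + 1)). \<forall>f\<in>densities r.
        risk (experiment_power (density_experiment r) n) (cell_loss m j) \<rho>' f
          \<le> risk (experiment_power (density_experiment r) (n + 1)) (cell_loss m j) \<rho> f + \<epsilon>"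
  defines "q \<equiv> (1 / r + (1 - 1 / r) * real m) / real m"
  shows "q * Bernstein n j q \<le> \<epsilon> + (real (n + 1))\<^sup>2 / real m + real (n + 1) / real m"
proof -
  let ?A = "cell_actions m (n + 1)"
  let ?U = "PiM {..<n} (\<lambda>_. unit_lebesgue)"
  let ?P = "\<lambda>\<sigma> n. PiM {..<n} (\<lambda>_. density unit_lebesgue (\<lambda>x. ennreal (spiked r m \<sigma> x)))"
  let ?l = "\<lambda>x. cells (cell m) n x"
  have m0: "0 < m" using m by simp
  have p0: "0 \<le> 1 / r" "0 \<le> (1 - 1 / r) * real m" using r by auto
  have PU: "prob_space ?U" by (intro prob_space_PiM prob_space_unit_lebesgue)
  obtain \<rho> where \<rho>: "\<rho> \<in> decision_procedures (experiment_power (density_experiment r) (n + 1)) ?A"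
    and \<rho>_risk: "\<And>\<sigma>. 1 < r \<Longrightarrow> 1 < m \<Longrightarrow> \<sigma> \<in> selectors m \<Longrightarrow>
      risk (experiment_power (density_experiment r) (n + 1)) (cell_loss m j) \<rho> (spiked r m \<sigma>)
        = (\<integral>x. of_bool (\<not> j < card (set (cells (cell m) (n + 1) x) \<inter> selected m \<sigma>)) \<partial>?P \<sigma> (n + 1))"
    by (rule report_cells_procedure[of r "n + 1" m j]) blast
  obtain \<rho>' where \<rho>': "\<rho>' \<in> decision_procedures (experiment_power (density_experiment r) n) ?A"
    and le: "\<And>f. f \<in> densities r \<Longrightarrow> risk (experiment_power (density_experiment r) n) (cell_loss m j) \<rho>' f
          \<le> risk (experiment_power (density_experiment r) (n + 1)) (cell_loss m j) \<rho> f + \<epsilon>"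
    using dom[OF \<rho>] by blast
  have k: "\<rho>' \<in> ?U \<rightarrow>\<^sub>M prob_algebra (count_space ?A)"
    using \<rho>' by (simp add: decision_procedures_def experiment_power_def density_experiment_def)
  have A: "finite ?A" by (rule finite_cell_actions)
  have mass: "(\<Sum>a\<in>?A. measure (\<rho>' x) {a}) = 1" if "x \<in> space ?U" for x
    by (rule finite_kernel_sum[OF k that A])
  define H where "H = (\<lambda>\<sigma> x. unseen_hits \<rho>' ?A (selected m \<sigma>) (?l x) x)"
  have H_meas: "H \<sigma> \<in> borel_measurable ?U" for \<sigma>
    unfolding H_def unseen_hits_def
    by (intro borel_measurable_sum borel_measurable_times kernel_weights_measurable[OF k]
        cells_fun_measurable[OF cell_measurable, of "\<lambda>l. real (card ((set_decode _ - set l) \<inter> _))"])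
  have H_bnd: "\<bar>H \<sigma> x\<bar> \<le> real (n + 1)" and H_nn: "0 \<le> H \<sigma> x" if x: "x \<in> space ?U" for \<sigma> x
  proof -
    have "H \<sigma> x \<le> (\<Sum>a\<in>?A. measure (\<rho>' x) {a} * real (n + 1))"
      unfolding H_def unseen_hits_def
    proof (intro sum_mono mult_left_mono)
      fix a assume a: "a \<in> ?A"
      have "card ((set_decode a - set (?l x)) \<inter> selected m \<sigma>) \<le> card (set_decode a)"
        using cell_actions_decode[OF a] by (intro card_mono) auto
      then show "real (card ((set_decode a - set (?l x)) \<inter> selected m \<sigma>)) \<le> real (n + 1)"
        using cell_actions_decode(2)[OF a] by simp
    qed simp
    also have "\<dots> = real (n + 1)" using mass[OF x] by (simp add: sum_distrib_right[symmetric])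
    finally have u: "H \<sigma> x \<le> real (n + 1)" .
    show n: "0 \<le> H \<sigma> x" unfolding H_def unseen_hits_def by (intro sum_nonneg) auto
    show "\<bar>H \<sigma> x\<bar> \<le> real (n + 1)" using u n by simp
  qed
  \<comment> \<open>The likelihood of \<open>\<sigma>\<close> relative to uniform sampling brings
    all selectors under the single measure \<open>?U\<close>.\<close>
  define W where "W = (\<lambda>\<sigma> x. list_weight (1 / r) ((1 - 1 / r) * real m) (selected m \<sigma>) (?l x))"
  have W_meas: "W \<sigma> \<in> borel_measurable ?U" for \<sigma>
    unfolding W_def by (rule cells_fun_measurable[OF cell_measurable])
  have W_nn: "0 \<le> W \<sigma> x" for \<sigma> x unfolding W_def by (intro list_weight_nonneg p0)

  have P_dens: "?P \<sigma> n = density ?U (\<lambda>x. ennreal (\<Prod>i<n. spiked r m \<sigma> (x i)))"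
    if \<sigma>: "\<sigma> \<in> selectors m" for \<sigma>
  proof (rule PiM_density[OF prob_space_unit_lebesgue spiked_measurable])
    show "0 \<le> spiked r m \<sigma> u" if "u \<in> space unit_lebesgue" for u
      using order_trans[OF p0(1) spiked_lower[OF r, of u m \<sigma>]] that by simp
    show "prob_space (density unit_lebesgue (\<lambda>u. ennreal (spiked r m \<sigma> u)))"
      by (rule prob_space_density_experiment[OF _ spiked_density[OF r m0 \<sigma>]]) (use r in simp)
  qed simp
  have P_int: "(\<integral>x. h x \<partial>?P \<sigma> n) = (\<integral>x. W \<sigma> x * h x \<partial>?U)"
    if \<sigma>: "\<sigma> \<in> selectors m" and h: "h \<in> borel_measurable ?U" for \<sigma> and h :: "_ \<Rightarrow> real"
  proof -
    have "?P \<sigma> n = density ?U (\<lambda>x. ennreal (W \<sigma> x))"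
      unfolding P_dens[OF \<sigma>]
    proof (intro density_cong AE_I2)
      show "(\<lambda>x. ennreal (\<Prod>i<n. spiked r m \<sigma> (x i))) \<in> borel_measurable ?U"
        by (intro measurable_compose[OF _ measurable_ennreal] borel_measurable_prod
            measurable_compose[OF measurable_component_singleton]) (auto intro: spiked_measurable)
      show "(\<lambda>x. ennreal (W \<sigma> x)) \<in> borel_measurable ?U"
        by (intro measurable_compose[OF _ measurable_ennreal] W_meas)
    qed (simp add: spiked_likelihood W_def)
    then have "(\<integral>x. h x \<partial>?P \<sigma> n) = (\<integral>x. h x \<partial>density ?U (\<lambda>x. ennreal (W \<sigma> x)))" by simp
    also have "\<dots> = (\<integral>x. W \<sigma> x *\<^sub>R h x \<partial>?U)"
      using W_nn by (intro integral_density h W_meas) auto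
    finally show ?thesis by simp
  qed
  have PP: "prob_space (?P \<sigma> k)" if \<sigma>: "\<sigma> \<in> selectors m" for \<sigma> k
    by (intro prob_space_PiM prob_space_density_experiment[OF _ spiked_density[OF r m0 \<sigma>]]) (use r in simp)
  \<comment> \<open>A crude bound, wanted for integrability.\<close>
  have W_bnd: "\<exists>C. \<forall>x. \<bar>W \<sigma> x\<bar> \<le> C" for \<sigma>
  proof -
    have bound: "list_weight (1 / r) ((1 - 1 / r) * real m) S l \<le> (1 / r + (1 - 1 / r) * real m) ^ length l" for S l
    proof (induction l)
      case (Cons t l)
      have "(1 / r + (1 - 1 / r) * real m * of_bool (t \<in> S)) * list_weight (1 / r) ((1 - 1 / r) * real m) S l
          \<le> (1 / r + (1 - 1 / r) * real m) * (1 / r + (1 - 1 / r) * real m) ^ length l"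
        using p0 by (intro mult_mono Cons list_weight_nonneg add_nonneg_nonneg) auto
      then show ?case by (simp add: list_weight_def)
    qed (simp add: list_weight_def)
    have "\<bar>W \<sigma> x\<bar> \<le> (1 / r + (1 - 1 / r) * real m) ^ n" for x
      using bound[of "selected m \<sigma>" "?l x"] W_nn[of \<sigma> x] by (simp only: W_def length_cells abs_of_nonneg)
    then show ?thesis by blast
  qed
  have W_integrable: "integrable ?U (W \<sigma>)" for \<sigma>
    using W_bnd[of \<sigma>] integrable_prob_bounded[OF PU W_meas[of \<sigma>]] by blast
  have WH_integrable: "integrable ?U (\<lambda>x. W \<sigma> x * H \<sigma> x)" for \<sigma>
  proof (rule Bochner_Integration.integrable_bound)
    show "integrable ?U (\<lambda>x. real (n + 1) * W \<sigma> x)" using W_integrable by simp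
    show "(\<lambda>x. W \<sigma> x * H \<sigma> x) \<in> borel_measurable ?U" using W_meas H_meas by simp
    show "AE x in ?U. norm (W \<sigma> x * H \<sigma> x) \<le> norm (real (n + 1) * W \<sigma> x)"
    proof (rule AE_I2)
      fix x assume x: "x \<in> space ?U"
      have "W \<sigma> x * H \<sigma> x \<le> W \<sigma> x * real (n + 1)"
        using H_bnd[OF x, of \<sigma>] W_nn by (intro mult_left_mono) auto
      then show "norm (W \<sigma> x * H \<sigma> x) \<le> norm (real (n + 1) * W \<sigma> x)"
        using W_nn H_nn[OF x] by (simp add: abs_mult mult.commute)
    qed
  qed
  \<comment> \<open>The posterior bound holds for each sample, and each likelihood integrates to
    1.\<close>
  have bayes: "(\<Sum>\<sigma>\<in>selectors m. \<integral>x. H \<sigma> x \<partial>?P \<sigma> n) \<le> real (n + 1) / real m * real (card (selectors m))"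
  proof -
    have "(\<Sum>\<sigma>\<in>selectors m. \<integral>x. H \<sigma> x \<partial>?P \<sigma> n) = (\<Sum>\<sigma>\<in>selectors m. \<integral>x. W \<sigma> x * H \<sigma> x \<partial>?U)"
      by (intro sum.cong refl P_int H_meas)
    also have "\<dots> = (\<integral>x. (\<Sum>\<sigma>\<in>selectors m. W \<sigma> x * H \<sigma> x) \<partial>?U)"
      using WH_integrable by (intro Bochner_Integration.integral_sum[symmetric])
    also have "\<dots> \<le> (\<integral>x. real (n + 1) / real m * (\<Sum>\<sigma>\<in>selectors m. W \<sigma> x) \<partial>?U)"
    proof (rule integral_mono)
      show "integrable ?U (\<lambda>x. \<Sum>\<sigma>\<in>selectors m. W \<sigma> x * H \<sigma> x)"
        using WH_integrable by (intro Bochner_Integration.integrable_sum)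
      show "integrable ?U (\<lambda>x. real (n + 1) / real m * (\<Sum>\<sigma>\<in>selectors m. W \<sigma> x))"
        using W_integrable by (intro integrable_mult_right Bochner_Integration.integrable_sum)
      fix x assume "x \<in> space ?U"
      then show "(\<Sum>\<sigma>\<in>selectors m. W \<sigma> x * H \<sigma> x) \<le> real (n + 1) / real m * (\<Sum>\<sigma>\<in>selectors m. W \<sigma> x)"
        unfolding W_def H_def using cell_actions_decode
        by (intro unseen_hits_posterior p0 m0 A mass) auto
    qed
    also have "\<dots> = real (n + 1) / real m * (\<Sum>\<sigma>\<in>selectors m. \<integral>x. W \<sigma> x \<partial>?U)"
      using W_integrable by (simp add: Bochner_Integration.integral_sum)
    also have "(\<Sum>\<sigma>\<in>selectors m. \<integral>x. W \<sigma> x \<partial>?U) = (\<Sum>\<sigma>\<in>selectors m. 1)"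
    proof (rule sum.cong[OF refl])
      fix \<sigma> assume \<sigma>: "\<sigma> \<in> selectors m"
      show "(\<integral>x. W \<sigma> x \<partial>?U) = 1"
        using P_int[OF \<sigma>, of "\<lambda>_. 1"] prob_space.prob_space[OF PP[OF \<sigma>, of n]] by simp
    qed
    finally show ?thesis by simp
  qed
  have single: "q * Bernstein n j q \<le> \<epsilon> + (real (n + 1))\<^sup>2 / real m + (\<integral>x. H \<sigma> x \<partial>?P \<sigma> n)"
    if \<sigma>: "\<sigma> \<in> selectors m" for \<sigma>
  proof -
    let ?S = "selected m \<sigma>"
    note cs = cell_sample_spiked[OF r m0 \<sigma>]
    interpret CS: cell_sample "density unit_lebesgue (\<lambda>x. ennreal (spiked r m \<sigma> x))" "cell m" ?S q
      unfolding q_def by (rule cs(1))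
    interpret Pn: prob_space "?P \<sigma> n" by (rule PP[OF \<sigma>])
    interpret Pn1: prob_space "?P \<sigma> (Suc n)" by (rule PP[OF \<sigma>])
    let ?Q = "\<lambda>l. card (set l \<inter> ?S) \<noteq> count_in ?S l"
    have "risk (experiment_power (density_experiment r) (n + 1)) (cell_loss m j) \<rho> (spiked r m \<sigma>)
        = CS.pr (Suc n) (\<lambda>l. \<not> j < card (set l \<inter> ?S))"
      unfolding \<rho>_risk[OF r m \<sigma>] CS.pr_def by simp
    \<comment> \<open>Without a collision the loss is 1 exactly when the count does not exceed
      \<open>j\<close>; with one, the last indicator alone bounds it.\<close>
    also have "\<dots> \<le> (\<integral>x. (1 - of_bool (j < count_in ?S (cells (cell m) (Suc n) x)))
        + of_bool (?Q (cells (cell m) (Suc n) x)) \<partial>?P \<sigma> (Suc n))"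
      unfolding CS.pr_def
    proof (rule integral_mono)
      show "integrable (?P \<sigma> (Suc n)) (\<lambda>x. of_bool (\<not> j < card (set (cells (cell m) (Suc n) x) \<inter> ?S)) :: real)"
        by (rule CS.integrable_pr)
      show "integrable (?P \<sigma> (Suc n)) (\<lambda>x. (1 - of_bool (j < count_in ?S (cells (cell m) (Suc n) x)))
          + of_bool (?Q (cells (cell m) (Suc n) x)) :: real)"
        using CS.integrable_pr[of "Suc n" "\<lambda>l. j < count_in ?S l"] CS.integrable_pr[of "Suc n" ?Q] by auto
      show "(of_bool (\<not> j < card (set (cells (cell m) (Suc n) x) \<inter> ?S)) :: real)
          \<le> (1 - of_bool (j < count_in ?S (cells (cell m) (Suc n) x))) + of_bool (?Q (cells (cell m) (Suc n) x))" for x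
        by (cases "?Q (cells (cell m) (Suc n) x)") (auto simp: of_bool_def)
    qed
    also have "\<dots> = 1 - CS.pr (Suc n) (\<lambda>l. j < count_in ?S l) + CS.pr (Suc n) ?Q"
      unfolding CS.pr_def
      using CS.integrable_pr[of "Suc n" "\<lambda>l. j < count_in ?S l"] CS.integrable_pr[of "Suc n" ?Q]
      by (simp add: Pn1.prob_space del: space_PiM_density)
    also have "CS.pr (Suc n) ?Q \<le> (real (Suc n))\<^sup>2 * (1 / real m)"
      using cs(2) by (intro CS.pr_collision) auto
    also have "CS.pr (Suc n) (\<lambda>l. j < count_in ?S l) = CS.pr n (\<lambda>l. j < count_in ?S l) + q * Bernstein n j q"
      by (rule CS.pr_count_gt_Suc)
    finally have up: "risk (experiment_power (density_experiment r) (n + 1)) (cell_loss m j) \<rho> (spiked r m \<sigma>)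
        \<le> 1 - (CS.pr n (\<lambda>l. j < count_in ?S l) + q * Bernstein n j q) + (real (Suc n))\<^sup>2 * (1 / real m)" by simp
    have H_int: "integrable (?P \<sigma> n) (H \<sigma>)"
      using H_meas[of \<sigma>] H_bnd[of _ \<sigma>]
      by (intro integrable_prob_bounded[OF PP[OF \<sigma>], of _ _ "real (n + 1)"])
        (simp_all add: measurable_PiM_density)
    \<comment> \<open>Averaging \<open>of_bool_hits_le\<close> over the random action bounds the
      risk of \<open>\<rho>'\<close> from below, whatever procedure it is.\<close>
    have "1 - CS.pr n (\<lambda>l. j < count_in ?S l) - (\<integral>x. H \<sigma> x \<partial>?P \<sigma> n)
        = (\<integral>x. 1 - of_bool (j < count_in ?S (?l x)) - H \<sigma> x \<partial>?P \<sigma> n)"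
      unfolding CS.pr_def using CS.integrable_pr[of n "\<lambda>l. j < count_in ?S l"] H_int
      by (simp add: Pn.prob_space del: space_PiM_density)
    also have "\<dots> \<le> (\<integral>x. (\<Sum>a\<in>?A. cell_loss m j a (spiked r m \<sigma>) * measure (\<rho>' x) {a}) \<partial>?P \<sigma> n)"
    proof (rule integral_mono)
      show "integrable (?P \<sigma> n) (\<lambda>x. 1 - of_bool (j < count_in ?S (?l x)) - H \<sigma> x)"
        using CS.integrable_pr[of n "\<lambda>l. j < count_in ?S l"] H_int by auto
      show "integrable (?P \<sigma> n) (\<lambda>x. \<Sum>a\<in>?A. cell_loss m j a (spiked r m \<sigma>) * measure (\<rho>' x) {a})"
      proof (rule integrable_prob_bounded[OF PP[OF \<sigma>], of _ _ 1])
        show "(\<lambda>x. \<Sum>a\<in>?A. cell_loss m j a (spiked r m \<sigma>) * measure (\<rho>' x) {a}) \<in> borel_measurable (?P \<sigma> n)"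
          unfolding measurable_PiM_density
          by (intro borel_measurable_sum borel_measurable_times kernel_weights_measurable[OF k]) auto
        fix x assume "x \<in> space (?P \<sigma> n)"
        then have "(\<Sum>a\<in>?A. cell_loss m j a (spiked r m \<sigma>) * measure (\<rho>' x) {a}) \<in> {0..1}"
          by (intro finite_kernel_integral_bounds[OF k _ A]) (auto simp: cell_loss_def)
        then show "\<bar>\<Sum>a\<in>?A. cell_loss m j a (spiked r m \<sigma>) * measure (\<rho>' x) {a}\<bar> \<le> 1" by simp
      qed
      fix x assume "x \<in> space (?P \<sigma> n)"
      then have x: "x \<in> space ?U" by simp
      have mix: "b - (\<Sum>a\<in>?A. w a * h a) = (\<Sum>a\<in>?A. (b - h a) * w a)" if "(\<Sum>a\<in>?A. w a) = 1"
        for b :: real and w h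
        unfolding left_diff_distrib sum_subtractf sum_distrib_left[symmetric] that by (simp add: mult.commute)
      have "1 - of_bool (j < count_in ?S (?l x)) - H \<sigma> x
          = (\<Sum>a\<in>?A. (1 - of_bool (j < count_in ?S (?l x))
              - real (card ((set_decode a - set (?l x)) \<inter> ?S))) * measure (\<rho>' x) {a})"
        unfolding H_def unseen_hits_def by (rule mix) (rule mass[OF x])
      also have "\<dots> \<le> (\<Sum>a\<in>?A. cell_loss m j a (spiked r m \<sigma>) * measure (\<rho>' x) {a})"
      proof (intro sum_mono mult_right_mono)
        fix a assume a: "a \<in> ?A"
        show "1 - of_bool (j < count_in ?S (?l x)) - real (card ((set_decode a - set (?l x)) \<inter> ?S))
            \<le> cell_loss m j a (spiked r m \<sigma>)"
          using of_bool_hits_le[OF cell_actions_decode(1)[OF a], of j ?S "?l x"]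
          unfolding cell_loss_spiked[OF r m] of_bool_not_iff by linarith
      qed simp
      finally show "1 - of_bool (j < count_in ?S (?l x)) - H \<sigma> x
          \<le> (\<Sum>a\<in>?A. cell_loss m j a (spiked r m \<sigma>) * measure (\<rho>' x) {a})" .
    qed
    also have "\<dots> = risk (experiment_power (density_experiment r) n) (cell_loss m j) \<rho>' (spiked r m \<sigma>)"
      by (rule risk_density_experiment_power[OF \<rho>' A, symmetric])
    also have "\<dots> \<le> risk (experiment_power (density_experiment r) (n + 1)) (cell_loss m j) \<rho> (spiked r m \<sigma>) + \<epsilon>"
      by (rule le[OF spiked_density[OF r m0 \<sigma>]])
    finally show ?thesis using up by simp
  qed
  have "real (card (selectors m)) * (q * Bernstein n j q)
      \<le> (\<Sum>\<sigma>\<in>selectors m. \<epsilon> + (real (n + 1))\<^sup>2 / real m + (\<integral>x. H \<sigma> x \<partial>?P \<sigma> n))"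
    using sum_mono[OF single] by simp
  also have "\<dots> \<le> real (card (selectors m)) * (\<epsilon> + (real (n + 1))\<^sup>2 / real m + real (n + 1) / real m)"
    using bayes by (simp add: sum.distrib algebra_simps)
  finally show ?thesis
    using selectors_nonempty[of m] by (simp add: card_gt_0_iff)
qed

section \<open>Bounds on the deficiency\<close>

text \<open>As \<open>m\<close> grows, the error terms of \<open>spiked_separation\<close> vanish
  while \<open>q\<close> stays at least 1 - 1/r, so \<open>Bernstein_mode\<close> applies with a
  bound free of \<open>m\<close>.\<close>

lemma deficiency_lower_step:
  assumes r: "1 < r" and n: "0 < n"
    and \<epsilon>: "\<And>A L \<rho>. decision_problem (densities r) A L \<Longrightarrow>
      \<rho> \<in> decision_procedures (experiment_power (density_experiment r) (n + 1)) A \<Longrightarrow>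
      \<exists>\<rho>'\<in>decision_procedures (experiment_power (density_experiment r) n) A. \<forall>f\<in>densities r.
        risk (experiment_power (density_experiment r) n) L \<rho>' f
          \<le> risk (experiment_power (density_experiment r) (n + 1)) L \<rho> f + \<epsilon>"
  shows "(1 - 1 / r) / (2 * (sqrt 2 * sqrt (real n) + 1)) \<le> \<epsilon>"
proof (rule field_le_epsilon)
  fix \<eta> :: real assume \<eta>: "0 < \<eta>"
  define K where "K = (real (n + 1))\<^sup>2 + real (n + 1)"
  \<comment> \<open>Large enough to push the error \<open>K / m\<close> below \<open>\<eta>\<close>,
    and above 1 so that the loss can recover the selected cells.\<close>
  obtain m :: nat where m: "max 2 (K / \<eta>) < real m" using reals_Archimedean2 by blast
  then have m1: "1 < m" "0 < m" by auto
  have "K < \<eta> * real m" using m \<eta> by (simp add: pos_divide_less_eq mult.commute)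
  then have K: "K / real m \<le> \<eta>" using m1 by (simp add: divide_le_eq)
  define q where "q = (1 / r + (1 - 1 / r) * real m) / real m"
  have r0: "0 < 1 / r" "1 / r < 1" using r by auto
  have q_ge: "1 - 1 / r \<le> q" using m1 r0 by (simp add: q_def add_divide_distrib)
  have "1 / r * 1 \<le> 1 / r * real m" using r0 m1 by (intro mult_left_mono) auto
  then have "1 / r + (1 - 1 / r) * real m \<le> real m" by (simp add: algebra_simps)
  then have q_le: "q \<le> 1" using m1 by (simp add: q_def)
  \<comment> \<open>The threshold depends on \<open>q\<close> and hence on \<open>m\<close>; this is
    harmless, as the decision problem is fixed only afterwards.\<close>
  obtain j where j: "1 / (2 * (sqrt 2 * sqrt (real n) + 1)) \<le> Bernstein n j q"
    using Bernstein_mode[OF n, of q] q_ge q_le r0 by (metis diff_ge_0_iff_ge less_imp_le order_trans)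
  have dp: "decision_problem (densities r) (cell_actions m (n + 1)) (cell_loss m j)"
    by (simp add: decision_problem_def finite_cell_actions cell_loss_def)
  have "(1 - 1 / r) * (1 / (2 * (sqrt 2 * sqrt (real n) + 1))) \<le> q * Bernstein n j q"
    using q_ge j r0 by (intro mult_mono) (auto intro: order_trans[of 0 "1 - 1 / r"])
  also have "\<dots> \<le> \<epsilon> + (real (n + 1))\<^sup>2 / real m + real (n + 1) / real m"
    unfolding q_def by (rule spiked_separation[OF r m1(1) \<epsilon>[OF dp]])
  also have "\<dots> = \<epsilon> + K / real m" by (simp add: K_def add_divide_distrib)
  also have "\<dots> \<le> \<epsilon> + \<eta>" using K by simp
  finally show "(1 - 1 / r) / (2 * (sqrt 2 * sqrt (real n) + 1)) \<le> \<epsilon> + \<eta>" by simp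
qed

text \<open>Machin's formula bounds pi by 16 arctan(1/5). The value 16/5 suffices for
  \<open>sqrt (pi / 2) < 1.3\<close>, since 1.6 < 1.69.\<close>

lemma pi_le: "pi \<le> 16 / 5"
proof -
  have "0 < arctan (1 / 239)" by simp
  moreover have "arctan (1 / 5) \<le> 1 / 5" by (rule arctan_le_self) simp
  ultimately show ?thesis using machin by linarith
qed

theorem corollary1:
  fixes r :: real
  assumes "r > 1"
  shows "(\<forall>n::nat. n \<ge> 1 \<longrightarrow>
      (1 - 1 / r) / (12 * sqrt 2) * (1 / sqrt (real (n + 1)))
        \<le> deficiency (experiment_power (density_experiment r) n)
                     (experiment_power (density_experiment r) (n + 1))
    \<and> deficiency (experiment_power (density_experiment r) n)
                 (experiment_power (density_experiment r) (n + 1))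
        \<le> sqrt (pi / 2) * r * (1 / sqrt (real (n + 1))))
    \<and> sqrt (pi / 2) * r < 1.3 * r"
proof (intro conjI allI impI)
  have "sqrt (pi / 2) < 1.3"
    using pi_le by (intro real_less_lsqrt) (auto simp: power2_eq_square)
  then show "sqrt (pi / 2) * r < 1.3 * r" using assms by (intro mult_strict_right_mono) auto
  fix n :: nat assume n: "1 \<le> n"
  have params: "params (experiment_power (density_experiment r) n) = densities r"
    by (simp add: experiment_power_def density_experiment_def)
  define D where "D = {\<epsilon>. 0 \<le> \<epsilon> \<and>
       (\<forall>A L. decision_problem (densities r) A L \<longrightarrow>
         (\<forall>\<rho>\<in>decision_procedures (experiment_power (density_experiment r) (n + 1)) A.
           \<exists>\<rho>'\<in>decision_procedures (experiment_power (density_experiment r) n) A.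
           \<forall>\<theta>\<in>densities r. risk (experiment_power (density_experiment r) n) L \<rho>' \<theta>
             \<le> risk (experiment_power (density_experiment r) (n + 1)) L \<rho> \<theta> + \<epsilon>))}"
  have def: "deficiency (experiment_power (density_experiment r) n)
      (experiment_power (density_experiment r) (n + 1)) = Inf D"
    by (simp only: deficiency_def params D_def)
  \<comment> \<open>Gives the upper bound, and also the nonemptiness of \<open>D\<close> that the
    lower bound on its infimum requires.\<close>
  have mem: "r / sqrt (real (n + 1)) \<in> D"
    unfolding D_def using insertion_procedure[OF assms] assms by auto
  have bdd: "bdd_below D" by (rule bdd_belowI[of _ 0]) (simp add: D_def)
  \<comment> \<open>The insertion argument already yields the constant \<open>r\<close>; the stated
    one is at least as large.\<close>
  have "1 \<le> sqrt (pi / 2)" using pi_ge_two by simp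
  have "Inf D \<le> r / sqrt (real (n + 1))" by (rule cInf_lower[OF mem bdd])
  also have "\<dots> \<le> sqrt (pi / 2) * r / sqrt (real (n + 1))"
    using \<open>1 \<le> sqrt (pi / 2)\<close> assms by (intro divide_right_mono) (auto simp: mult_le_cancel_right2 mult_le_cancel_right1)
  finally show "deficiency (experiment_power (density_experiment r) n)
                 (experiment_power (density_experiment r) (n + 1))
        \<le> sqrt (pi / 2) * r * (1 / sqrt (real (n + 1)))" unfolding def by simp
  \<comment> \<open>With b = \<open>sqrt 2 * sqrt (n + 1)\<close>, which is at least 1, the left
    side is at most 4 b, well below 12 b.\<close>
  have "2 * (sqrt 2 * sqrt (real n) + 1) \<le> 12 * sqrt 2 * sqrt (real (n + 1))"
  proof -
    have "1 \<le> sqrt 2 * sqrt (real (n + 1))"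
      by (simp flip: real_sqrt_mult)
    moreover have "sqrt 2 * sqrt (real n) \<le> sqrt 2 * sqrt (real (n + 1))" by simp
    moreover have "2 * (a + 1) \<le> 12 * b" if "1 \<le> b" "a \<le> b" for a b :: real using that by auto
    ultimately have "2 * (sqrt 2 * sqrt (real n) + 1) \<le> 12 * (sqrt 2 * sqrt (real (n + 1)))" by blast
    then show ?thesis by (simp only: mult.assoc)
  qed
  then have "(1 - 1 / r) / (12 * sqrt 2 * sqrt (real (n + 1))) \<le> (1 - 1 / r) / (2 * (sqrt 2 * sqrt (real n) + 1))"
    using assms by (intro divide_left_mono) (auto intro!: mult_pos_pos add_nonneg_pos)
  also have "\<dots> \<le> Inf D"
  proof (rule cInf_greatest)
    show "D \<noteq> {}" using mem by blast
    fix \<epsilon> assume "\<epsilon> \<in> D"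
    then show "(1 - 1 / r) / (2 * (sqrt 2 * sqrt (real n) + 1)) \<le> \<epsilon>"
      using n by (intro deficiency_lower_step[OF assms]) (auto simp: D_def)
  qed
  finally show "(1 - 1 / r) / (12 * sqrt 2) * (1 / sqrt (real (n + 1)))
        \<le> deficiency (experiment_power (density_experiment r) n)
                     (experiment_power (density_experiment r) (n + 1))" unfolding def by simp
qed

end
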